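(* Fix $\beta\neq 0$ and suppose $\Delta_{\min}>0$. For any fixed $\delta\in(0,1]$, with probability at least $1-\delta$, the regret of Algorithm RSVI2 (run with inputs $K$, $\delta$, $\beta$) satisfies $$\mathcal{R}(K)\lesssim \frac{(e^{|\beta| H}-1)^2 H^3S^2A}{|\beta|^2\Delta_{\min}}\log(HSAK/\delta)^2 .$$ Moreover, for RSVI2 run with confidence parameter $\delta=1/(HK)$, the expected regret satisfies $$\mathbb{E}[\mathcal{R}(K)]\lesssim \frac{(e^{|\beta| H}-1)^2 H^3S^2A}{|\beta|^2\Delta_{\min}}\log(HSAK)^2 .$$
   Context: Episodic finite-horizon tabular MDP: finite state set $\mathcal{S}$ with $|\mathcal{S}|=S$, finite action set $\mathcal{A}$ with $|\mathcal{A}|=A$, horizon $H$, number of episodes $K$, transition kernels $\mathcal{P}_h(\cdot\mid s,a)$ for $h\in[H]$, and deterministic rewards $r_h:\mathcal{S}\times\mathcal{A}\to[0,1]$. Every episode starts at the same fixed state $s_1$; in episode $k$ at step $h$ the agent at $s_h^k$ takes $a_h^k$, receives $r_h(s_h^k,a_h^k)$ and moves to $s_{h+1}^k\sim\mathcal{P}_h(\cdot\mid s_h^k,a_h^k)$. A policy is $\pi=(\pi_h:\mathcal{S}\to\mathcal{A})_{h\in[H]}$. For risk parameter $\beta\ne0$: $V_h^\pi(s)=\frac1\beta\log\mathbb{E}[e^{\beta\sum_{i=h}^H r_i(s_i,\pi_i(s_i))}\mid s_h=s]$ and $Q_h^\pi(s,a)=\frac1\beta\log\mathbb{E}[e^{\beta\sum_{i=h}^H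 r_i(s_i,a_i)}\mid s_h=s,a_h=a]$ with $a_i=\pi_i(s_i)$ for $i>h$; $V_{H+1}^\pi\equiv 0$. $V_h^*=\sup_\pi V_h^\pi$, attained by an optimal policy $\pi^*$, and $Q_h^*=Q_h^{\pi^*}$. If the learner uses policy $\pi^k$ in episode $k$, the regret is $\mathcal{R}(K)=\sum_{k=1}^K (V_1^*-V_1^{\pi^k})(s_1)$. Trajectories: a trajectory is $\tau=((s_j,a_j))_{j\in[H]}\in(\mathcal{S}\times\mathcal{A})^H$; $\tau_h$ is its first $h$ pairs ($\tau_0$ empty); $R(\tau_0)=0$, $R(\tau_h)=\sum_{j=1}^h r_j(s_j,a_j)$. Cascaded gap: $\Delta_h(s,a;\tau_{h-1})=\psi_\beta e^{\beta R(\tau_{h-1})}[e^{\beta V_h^*(s)}-e^{\beta Q_h^*(s,a)}]$ with $\psi_\beta=1/\beta$ if $\beta>0$ and $\psi_\beta=e^{-\beta H}/\beta$ if $\beta<0$ (always $\ge0$). $\Delta_{\min}$ is the minimum of $\Delta_h(s,a;\tau_{h-1})$ over all $(h,s,a,\tau)$ for which it is nonzero. Notation $x\lesssim y$ means $x\le Cy$ for a universal constant $C>0$; $\log$ is natural. Algorithm RSVI2 (inputs $K$, $\delta\in(0,1]$, $\beta\neq0$; $c>0$ an appropriate universal constant): initialize $Q_h(s,a),V_h(s)\leftarrow H-h+1$, $w_h(s,a)\leftarrow0$, $N_h(s,a)\leftarrow0$ for all $(h,s,a)\in[H+1]\times\mathcal{S}\times\mathcal{A}$. In each episode $k=1,\dots,K$: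 for $h=H,\dots,1$ and each $(s,a)$ with $N_h(s,a)\ge1$, set $w_h(s,a)\leftarrow\frac{1}{N_h(s,a)}\sum_{i\in[k-1]}\mathbb{1}\{(s_h^i,a_h^i)=(s,a)\}e^{\beta[r_h(s,a)+V_{h+1}(s_{h+1}^i)]}$, $b_h(s,a)\leftarrow c|e^{\beta(H-h+1)}-1|\sqrt{S\log(2SAHK/\delta)/N_h(s,a)}$, $G_h(s,a)\leftarrow\min\{e^{\beta(H-h+1)},w_h(s,a)+b_h(s,a)\}$ if $\beta>0$ and $G_h(s,a)\leftarrow\max\{e^{\beta(H-h+1)},w_h(s,a)-b_h(s,a)\}$ if $\beta<0$, $Q_h(s,a)\leftarrow\frac1\beta\log G_h(s,a)$, and $V_h(s)\leftarrow\max_{a'}Q_h(s,a')$. Then for $h=1,\dots,H$: take $a_h\leftarrow\arg\max_a Q_h(s_h,a)$, observe $r_h(s_h,a_h)$ and $s_{h+1}$, and increment $N_h(s_h,a_h)$. *)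

theory Defs
  imports "HOL-Probability.Probability"
begin

text \<open>Episodic tabular MDP. States are the naturals below nS, actions the naturals
below nA; steps are indexed h = 1..H; every episode starts at init.\<close>

record mdp =
  nS :: nat
  nA :: nat
  horizon :: nat
  trans :: "nat \<Rightarrow> nat \<Rightarrow> nat \<Rightarrow> nat pmf"
  rew :: "nat \<Rightarrow> nat \<Rightarrow> nat \<Rightarrow> real"
  init :: nat

definition wf_mdp :: "mdp \<Rightarrow> bool" where
  "wf_mdp M \<longleftrightarrow> nS M \<ge> 1 \<and> nA M \<ge> 1 \<and> horizon M \<ge> 1 \<and> init M < nS M \<and>
     (\<forall>h\<in>{1..horizon M}. \<forall>s<nS M. \<forall>a<nA M.
        set_pmf (trans M h s a) \<subseteq> {..<nS M} \<and> 0 \<le> rew M h s a \<and> rew M h s a \<le> 1)"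

definition policies :: "mdp \<Rightarrow> (nat \<Rightarrow> nat \<Rightarrow> nat) set" where
  "policies M = {\<pi>. \<forall>h s. \<pi> h s < nA M}"

fun run_from :: "mdp \<Rightarrow> (nat \<Rightarrow> nat \<Rightarrow> nat) \<Rightarrow> nat \<Rightarrow> nat \<Rightarrow> nat \<Rightarrow> (nat list \<times> nat list) pmf" where
  "run_from M \<pi> h 0 s = return_pmf ([s], [])"
| "run_from M \<pi> h (Suc n) s =
     bind_pmf (trans M h s (\<pi> h s))
       (\<lambda>s'. map_pmf (\<lambda>(ss, as). (s # ss, \<pi> h s # as)) (run_from M \<pi> (Suc h) n s'))"

definition traj_reward :: "mdp \<Rightarrow> nat \<Rightarrow> nat list \<Rightarrow> nat list \<Rightarrow> real" where
  "traj_reward M h ss as = (\<Sum>j<length as. rew M (h + j) (ss ! j) (as ! j))"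

definition Vpi :: "mdp \<Rightarrow> real \<Rightarrow> (nat \<Rightarrow> nat \<Rightarrow> nat) \<Rightarrow> nat \<Rightarrow> nat \<Rightarrow> real" where
  "Vpi M \<beta> \<pi> h s =
     ln (measure_pmf.expectation (run_from M \<pi> h (horizon M + 1 - h) s)
           (\<lambda>(ss, as). exp (\<beta> * traj_reward M h ss as))) / \<beta>"

definition Qpi :: "mdp \<Rightarrow> real \<Rightarrow> (nat \<Rightarrow> nat \<Rightarrow> nat) \<Rightarrow> nat \<Rightarrow> nat \<Rightarrow> nat \<Rightarrow> real" where
  "Qpi M \<beta> \<pi> h s a = Vpi M \<beta> (\<pi>(h := (\<pi> h)(s := a))) h s"

definition Vstar :: "mdp \<Rightarrow> real \<Rightarrow> nat \<Rightarrow> nat \<Rightarrow> real" where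
  "Vstar M \<beta> h s = (SUP \<pi>\<in>policies M. Vpi M \<beta> \<pi> h s)"

definition optimal_policy :: "mdp \<Rightarrow> real \<Rightarrow> (nat \<Rightarrow> nat \<Rightarrow> nat) \<Rightarrow> bool" where
  "optimal_policy M \<beta> \<pi> \<longleftrightarrow> \<pi> \<in> policies M \<and>
     (\<forall>h\<in>{1..horizon M + 1}. \<forall>s<nS M. Vpi M \<beta> \<pi> h s = Vstar M \<beta> h s)"

definition Qstar :: "mdp \<Rightarrow> real \<Rightarrow> nat \<Rightarrow> nat \<Rightarrow> nat \<Rightarrow> real" where
  "Qstar M \<beta> h s a = Qpi M \<beta> (SOME \<pi>. optimal_policy M \<beta> \<pi>) h s a"

definition psi :: "real \<Rightarrow> nat \<Rightarrow> real" where
  "psi \<beta> H = (if \<beta> > 0 then 1 / \<beta> else exp (- \<beta> * real H) / \<beta>)"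

definition prefix_reward :: "mdp \<Rightarrow> (nat \<times> nat) list \<Rightarrow> nat \<Rightarrow> real" where
  "prefix_reward M \<tau> h = (\<Sum>j < h - 1. rew M (Suc j) (fst (\<tau> ! j)) (snd (\<tau> ! j)))"

definition gap :: "mdp \<Rightarrow> real \<Rightarrow> nat \<Rightarrow> nat \<Rightarrow> nat \<Rightarrow> (nat \<times> nat) list \<Rightarrow> real" where
  "gap M \<beta> h s a \<tau> = psi \<beta> (horizon M) * exp (\<beta> * prefix_reward M \<tau> h) *
      (exp (\<beta> * Vstar M \<beta> h s) - exp (\<beta> * Qstar M \<beta> h s a))"

definition gap_set :: "mdp \<Rightarrow> real \<Rightarrow> real set" where
  "gap_set M \<beta> = {gap M \<beta> h s a \<tau> | h s a \<tau>.
      h \<in> {1..horizon M} \<and> s < nS M \<and> a < nA M \<and> length \<tau> = horizon M \<and>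
      set \<tau> \<subseteq> {..<nS M} \<times> {..<nA M} \<and> gap M \<beta> h s a \<tau> \<noteq> 0}"

definition Delta_min :: "mdp \<Rightarrow> real \<Rightarrow> real" where
  "Delta_min M \<beta> = Min (gap_set M \<beta>)"

text \<open>Algorithm RSVI2. An episode is (states s_1..s_{H+1}, actions a_1..a_H).\<close>
type_synonym episode = "nat list \<times> nat list"

definition st :: "episode \<Rightarrow> nat \<Rightarrow> nat" where "st e h = fst e ! (h - 1)"
definition ac :: "episode \<Rightarrow> nat \<Rightarrow> nat" where "ac e h = snd e ! (h - 1)"

definition cnt :: "episode list \<Rightarrow> nat \<Rightarrow> nat \<Rightarrow> nat \<Rightarrow> nat" where
  "cnt D h s a = length (filter (\<lambda>e. st e h = s \<and> ac e h = a) D)"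

definition Qalg_step :: "mdp \<Rightarrow> real \<Rightarrow> real \<Rightarrow> nat \<Rightarrow> real \<Rightarrow> episode list \<Rightarrow> nat \<Rightarrow>
    (nat \<Rightarrow> real) \<Rightarrow> nat \<Rightarrow> nat \<Rightarrow> real" where
  "Qalg_step M \<beta> c K \<delta> D h Vn s a =
    (let n = cnt D h s a; Hh = real (horizon M - h + 1) in
     if n = 0 then Hh else
     let w = sum_list (map (\<lambda>e. if st e h = s \<and> ac e h = a
                                 then exp (\<beta> * (rew M h s a + Vn (st e (h + 1)))) else 0) D) / real n;
         b = c * \<bar>exp (\<beta> * Hh) - 1\<bar> *
             sqrt (real (nS M) * ln (2 * real (nS M) * real (nA M) * real (horizon M) * real K / \<delta>) / real n);
         G = (if \<beta> > 0 then min (exp (\<beta> * Hh)) (w + b) else max (exp (\<beta> * Hh)) (w - b))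
     in ln G / \<beta>)"

text \<open>Valg ... d s is the algorithm's V at step H + 1 - d.\<close>
primrec Valg :: "mdp \<Rightarrow> real \<Rightarrow> real \<Rightarrow> nat \<Rightarrow> real \<Rightarrow> episode list \<Rightarrow> nat \<Rightarrow> nat \<Rightarrow> real" where
  "Valg M \<beta> c K \<delta> D 0 s = 0"
| "Valg M \<beta> c K \<delta> D (Suc d) s =
     Max ((\<lambda>a. Qalg_step M \<beta> c K \<delta> D (horizon M - d) (Valg M \<beta> c K \<delta> D d) s a) ` {..<nA M})"

definition Qalg :: "mdp \<Rightarrow> real \<Rightarrow> real \<Rightarrow> nat \<Rightarrow> real \<Rightarrow> episode list \<Rightarrow> nat \<Rightarrow> nat \<Rightarrow> nat \<Rightarrow> real" where
  "Qalg M \<beta> c K \<delta> D h s a = Qalg_step M \<beta> c K \<delta> D h (Valg M \<beta> c K \<delta> D (horizon M - h)) s a"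

definition alg_policy :: "mdp \<Rightarrow> real \<Rightarrow> real \<Rightarrow> nat \<Rightarrow> real \<Rightarrow> episode list \<Rightarrow> nat \<Rightarrow> nat \<Rightarrow> nat" where
  "alg_policy M \<beta> c K \<delta> D h s =
     (SOME a. a < nA M \<and> (\<forall>a'<nA M. Qalg M \<beta> c K \<delta> D h s a' \<le> Qalg M \<beta> c K \<delta> D h s a))"

fun rsvi2_hist :: "mdp \<Rightarrow> real \<Rightarrow> real \<Rightarrow> nat \<Rightarrow> real \<Rightarrow> nat \<Rightarrow> episode list pmf" where
  "rsvi2_hist M \<beta> c K \<delta> 0 = return_pmf []"
| "rsvi2_hist M \<beta> c K \<delta> (Suc k) =
     bind_pmf (rsvi2_hist M \<beta> c K \<delta> k)
       (\<lambda>D. map_pmf (\<lambda>e. D @ [e]) (run_from M (alg_policy M \<beta> c K \<delta> D) 1 (horizon M) (init M)))"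

definition regret :: "mdp \<Rightarrow> real \<Rightarrow> real \<Rightarrow> nat \<Rightarrow> real \<Rightarrow> episode list \<Rightarrow> real" where
  "regret M \<beta> c K \<delta> D =
     (\<Sum>k<K. Vstar M \<beta> 1 (init M) - Vpi M \<beta> (alg_policy M \<beta> c K \<delta> (take k D)) 1 (init M))"

definition regret_scale :: "mdp \<Rightarrow> real \<Rightarrow> real" where
  "regret_scale M \<beta> = (exp (\<bar>\<beta>\<bar> * real (horizon M)) - 1)^2 * real (horizon M)^3 *
      real (nS M)^2 * real (nA M) / (\<bar>\<beta>\<bar>^2 * Delta_min M \<beta>)"

end

theory Submission
  imports Defs
begin

text \<open>On the event that all empirical transition frequencies are close to the kernels on every set of
successor states, the planned values are optimistic, and exponentiated overestimates satisfy a
linear Bellman recursion whose sources are the exploration bonuses. Weighting by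
\<open>\<psi> exp (\<beta> R(\<tau>))\<close> turns every bonus into at most \<open>B min (1, 4 \<surd>(S \<iota> / N))\<close> with
\<open>B = (exp (\<bar>\<beta>\<bar> H) - 1) / \<bar>\<beta>\<bar>\<close>, uniformly in the prefix \<open>\<tau>\<close>. A nonzero cascaded gap is at least
the minimal gap \<open>\<Delta>\<close>, so all bonuses can be reduced by \<open>\<Delta> / (2 H)\<close> at the price of a factor two: each gap is at
most twice the expected sum of clipped bonuses to come, and the regret of an episode is at most
\<open>2 H\<close> times the expected sum \<open>F\<close> of clipped bonuses. A clipped bonus vanishes once \<open>N\<close> is of order
\<open>H\<^sup>2 B\<^sup>2 S \<iota> / \<Delta>\<^sup>2\<close>, so the realised sum over all episodes is of order
\<open>H\<^sup>2 S\<^sup>2 A B\<^sup>2 \<iota> / \<Delta>\<close>, which depends on \<open>K\<close> through \<open>\<iota>\<close> only. An exponential supermartingale bounds the sum of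
the conditional expectations \<open>F\<close> by twice the realised sum plus a logarithmic term.\<close>

section \<open>Expectations under finitely supported distributions\<close>

abbreviation (input) E :: "'a pmf \<Rightarrow> ('a \<Rightarrow> real) \<Rightarrow> real" where
  "E p f \<equiv> measure_pmf.expectation p f"

text \<open>Every distribution that occurs has finite support, so expectations are finite sums and
  integrability is automatic.\<close>

lemma E_bind:
  assumes "finite (set_pmf p)" "\<And>x. x \<in> set_pmf p \<Longrightarrow> finite (set_pmf (q x))"
  shows "E (bind_pmf p q) f = E p (\<lambda>x. E (q x) f)"
proof -
  have "E (bind_pmf p q) f = (\<Sum>a\<in>set_pmf p. pmf p a *\<^sub>R E (q a) f)"
    using assms by (intro pmf_expectation_bind) auto
  also have "\<dots> = E p (\<lambda>x. E (q x) f)"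
    using assms(1) by (subst integral_measure_pmf_real[of "set_pmf p"]) (auto simp: mult.commute)
  finally show ?thesis .
qed

lemma E_mono:
  assumes "finite (set_pmf p)" "\<And>x. x \<in> set_pmf p \<Longrightarrow> f x \<le> g x"
  shows "E p f \<le> E p g"
  using assms by (intro integral_mono_AE integrable_measure_pmf_finite) (auto simp: AE_measure_pmf_iff)

lemma E_cong:
  assumes "\<And>x. x \<in> set_pmf p \<Longrightarrow> f x = g x"
  shows "E p f = E p g"
  using assms by (intro integral_cong_AE) (auto simp: AE_measure_pmf_iff)

lemma E_add:
  "finite (set_pmf p) \<Longrightarrow> E p (\<lambda>x. f x + g x) = E p f + E p g"
  by (intro Bochner_Integration.integral_add integrable_measure_pmf_finite)

lemma E_diff:
  "finite (set_pmf p) \<Longrightarrow> E p (\<lambda>x. f x - g x) = E p f - E p g"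
  by (intro Bochner_Integration.integral_diff integrable_measure_pmf_finite)

lemma E_le_const:
  "finite (set_pmf p) \<Longrightarrow> (\<And>x. x \<in> set_pmf p \<Longrightarrow> f x \<le> c) \<Longrightarrow> E p f \<le> c"
  using E_mono[of p f "\<lambda>_. c"] by simp

lemma E_ge_const:
  "finite (set_pmf p) \<Longrightarrow> (\<And>x. x \<in> set_pmf p \<Longrightarrow> c \<le> f x) \<Longrightarrow> c \<le> E p f"
  using E_mono[of p "\<lambda>_. c" f] by simp

lemma E_pos:
  assumes "finite (set_pmf p)" "\<And>x. x \<in> set_pmf p \<Longrightarrow> 0 < f x"
  shows "0 < E p f"
proof -
  have "0 < Min (f ` set_pmf p)"
    using assms by (subst Min_gr_iff) (auto simp: set_pmf_not_empty)
  also have "\<dots> \<le> E p f"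
    using assms by (intro E_ge_const) auto
  finally show ?thesis .
qed

lemma E_sum_pmf:
  "finite X \<Longrightarrow> set_pmf p \<subseteq> X \<Longrightarrow> E p f = (\<Sum>x\<in>X. pmf p x * f x)"
  by (subst integral_measure_pmf_real[of X]) (auto simp: mult.commute)

text \<open>Markov's inequality in product form: \<open>t\<close> times the indicator of the event
  is pointwise at most \<open>f\<close> on the support, whatever the sign of
  \<open>t\<close>.\<close>

lemma prob_ge_times_le_E:
  assumes "finite (set_pmf p)" "\<And>x. x \<in> set_pmf p \<Longrightarrow> 0 \<le> f x"
  shows "measure_pmf.prob p {x. t \<le> f x} * t \<le> E p f"
proof -
  have "measure_pmf.prob p {x. t \<le> f x} * t = E p (\<lambda>x. indicator {x. t \<le> f x} x * t)"
    by simp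
  also have "\<dots> \<le> E p f"
    using assms by (intro E_mono) (auto simp: indicator_def)
  finally show ?thesis .
qed

section \<open>Trajectories\<close>

text \<open>One additive functional serves both the rewards and the clipped bonuses. The index runs
  over the actions because the state list has one extra final entry.\<close>

definition path_sum :: "(nat \<Rightarrow> nat \<Rightarrow> nat \<Rightarrow> real) \<Rightarrow> nat \<Rightarrow> episode \<Rightarrow> real" where
  "path_sum f h e = (\<Sum>j<length (snd e). f (h + j) (fst e ! j) (snd e ! j))"

lemma path_sum_Cons:
  "path_sum f h (s # ss, a # as) = f h s a + path_sum f (Suc h) (ss, as)"
  unfolding path_sum_def by (simp add: sum.lessThan_Suc_shift del: sum.lessThan_Suc)

lemma traj_reward_path_sum: "traj_reward M h ss as = path_sum (rew M) h (ss, as)"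
  by (simp add: traj_reward_def path_sum_def)

text \<open>A run started at step \<open>h\<close> consults the policy only from \<open>h\<close>
  on. This shows that the change made at step \<open>h\<close> in \<open>Qpi\<close> leaves the
  later values alone.\<close>

lemma run_from_cong:
  assumes "\<And>h' s. h \<le> h' \<Longrightarrow> \<pi> h' s = \<pi>' h' s"
  shows "run_from M \<pi> h n s = run_from M \<pi>' h n s"
  using assms
proof (induction n arbitrary: h s)
  case (Suc n)
  have "run_from M \<pi> (Suc h) n = run_from M \<pi>' (Suc h) n"
    using Suc by (intro ext) auto
  then show ?case using Suc.prems[of h s] by simp
qed simp

locale risk_mdp =
  fixes M :: mdp and \<beta> :: real
  assumes wf: "wf_mdp M" and beta: "\<beta> \<noteq> 0"
begin

abbreviation S where "S \<equiv> nS M"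
abbreviation A where "A \<equiv> nA M"
abbreviation H where "H \<equiv> horizon M"

lemma S_pos: "1 \<le> S" and A_pos: "1 \<le> A" and H_pos: "1 \<le> H" and init_less: "init M < S"
  using wf by (auto simp: wf_mdp_def)

lemma set_trans:
  "1 \<le> h \<Longrightarrow> h \<le> H \<Longrightarrow> s < S \<Longrightarrow> a < A \<Longrightarrow> set_pmf (trans M h s a) \<subseteq> {..<S}"
  using wf by (auto simp: wf_mdp_def)

lemma finite_trans:
  "1 \<le> h \<Longrightarrow> h \<le> H \<Longrightarrow> s < S \<Longrightarrow> a < A \<Longrightarrow> finite (set_pmf (trans M h s a))"
  using set_trans by (meson finite_lessThan finite_subset)

lemma rew_bounds:
  "1 \<le> h \<Longrightarrow> h \<le> H \<Longrightarrow> s < S \<Longrightarrow> a < A \<Longrightarrow> 0 \<le> rew M h s a \<and> rew M h s a \<le> 1"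
  using wf by (auto simp: wf_mdp_def)

lemma policyD: "\<pi> \<in> policies M \<Longrightarrow> \<pi> h s < A"
  by (auto simp: policies_def)

lemma trans_policy:
  assumes "\<pi> \<in> policies M" "1 \<le> h" "h \<le> H" "s < S"
  shows "finite (set_pmf (trans M h s (\<pi> h s)))" "set_pmf (trans M h s (\<pi> h s)) \<subseteq> {..<S}"
  using finite_trans set_trans assms policyD by blast+

lemma set_run_from:
  assumes "\<pi> \<in> policies M" "1 \<le> h" "h + n \<le> Suc H" "s < S" "e \<in> set_pmf (run_from M \<pi> h n s)"
  shows "length (fst e) = Suc n" "length (snd e) = n" "set (fst e) \<subseteq> {..<S}" "set (snd e) \<subseteq> {..<A}"
    "fst e ! 0 = s"
proof -
  have "length (fst e) = Suc n \<and> length (snd e) = n \<and> set (fst e) \<subseteq> {..<S} \<and>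
      set (snd e) \<subseteq> {..<A} \<and> fst e ! 0 = s"
    using assms
  proof (induction n arbitrary: h s e)
    case (Suc n)
    then obtain s' ss as where s': "s' \<in> set_pmf (trans M h s (\<pi> h s))"
      and e': "(ss, as) \<in> set_pmf (run_from M \<pi> (Suc h) n s')" and e: "e = (s # ss, \<pi> h s # as)"
      by auto
    have "s' < S"
      using s' set_trans[of h s "\<pi> h s"] Suc.prems policyD by auto
    then show ?case
      using Suc.IH[OF Suc.prems(1) _ _ _ e'] Suc.prems e policyD by auto
  qed simp
  then show "length (fst e) = Suc n" "length (snd e) = n" "set (fst e) \<subseteq> {..<S}"
    "set (snd e) \<subseteq> {..<A}" "fst e ! 0 = s" by auto
qed

lemma finite_run_from:
  assumes "\<pi> \<in> policies M" "1 \<le> h" "h + n \<le> Suc H" "s < S"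
  shows "finite (set_pmf (run_from M \<pi> h n s))"
proof (rule finite_subset)
  show "set_pmf (run_from M \<pi> h n s) \<subseteq>
      {xs. set xs \<subseteq> {..<S} \<and> length xs = Suc n} \<times> {xs. set xs \<subseteq> {..<A} \<and> length xs = n}"
    using set_run_from[OF assms] by (fastforce simp: subset_iff)
  show "finite ({xs. set xs \<subseteq> {..<S} \<and> length xs = Suc n} \<times> {xs. set xs \<subseteq> {..<A} \<and> length xs = n})"
    by (intro finite_cartesian_product finite_lists_length_eq) auto
qed

lemma E_run_from_Suc:
  assumes "\<pi> \<in> policies M" "1 \<le> h" "h + Suc n \<le> Suc H" "s < S"
  shows "E (run_from M \<pi> h (Suc n) s) \<phi> =
    E (trans M h s (\<pi> h s)) (\<lambda>s'. E (run_from M \<pi> (Suc h) n s')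
      (\<lambda>(ss, as). \<phi> (s # ss, \<pi> h s # as)))"
proof -
  have t: "finite (set_pmf (trans M h s (\<pi> h s)))" "set_pmf (trans M h s (\<pi> h s)) \<subseteq> {..<S}"
    using assms trans_policy[of \<pi> h s] by auto
  have "E (run_from M \<pi> h (Suc n) s) \<phi> =
      E (trans M h s (\<pi> h s)) (\<lambda>s'. E (map_pmf (\<lambda>(ss, as). (s # ss, \<pi> h s # as))
        (run_from M \<pi> (Suc h) n s')) \<phi>)"
    unfolding run_from.simps using t assms
    by (subst E_bind) (auto intro!: finite_imageI finite_run_from)
  then show ?thesis by (simp add: case_prod_unfold)
qed

lemma E_path_sum_Suc:
  assumes "\<pi> \<in> policies M" "1 \<le> h" "h + Suc n \<le> Suc H" "s < S"
  shows "E (run_from M \<pi> h (Suc n) s) (path_sum f h) =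
    f h s (\<pi> h s) + E (trans M h s (\<pi> h s)) (\<lambda>s'. E (run_from M \<pi> (Suc h) n s') (path_sum f (Suc h)))"
proof -
  have t: "finite (set_pmf (trans M h s (\<pi> h s)))" "set_pmf (trans M h s (\<pi> h s)) \<subseteq> {..<S}"
    using assms trans_policy[of \<pi> h s] by auto
  have "E (run_from M \<pi> h (Suc n) s) (path_sum f h) =
      E (trans M h s (\<pi> h s)) (\<lambda>s'. E (run_from M \<pi> (Suc h) n s')
        (\<lambda>e. f h s (\<pi> h s) + path_sum f (Suc h) e))"
    by (subst E_run_from_Suc[OF assms]) (simp add: path_sum_Cons case_prod_unfold)
  also have "\<dots> = E (trans M h s (\<pi> h s)) (\<lambda>s'. f h s (\<pi> h s) +
      E (run_from M \<pi> (Suc h) n s') (path_sum f (Suc h)))"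
    using t assms by (intro E_cong) (auto simp: E_add finite_run_from)
  also have "\<dots> = f h s (\<pi> h s) +
      E (trans M h s (\<pi> h s)) (\<lambda>s'. E (run_from M \<pi> (Suc h) n s') (path_sum f (Suc h)))"
    using t by (subst E_add) auto
  finally show ?thesis .
qed

text \<open>Conditioning on the trajectory up to step \<open>h + j\<close> leaves one transition to
  average, and the bound for it holds in every state. Exponential deviation factors are integrated
  over a whole episode in this way.\<close>

lemma E_run_from_step_le_1:
  assumes "\<pi> \<in> policies M" "1 \<le> h" "h + n \<le> Suc H" "s < S" "j < n"
    and "\<And>s. s < S \<Longrightarrow> E (trans M (h + j) s (\<pi> (h + j) s)) (\<phi> s (\<pi> (h + j) s)) \<le> 1"
  shows "E (run_from M \<pi> h n s) (\<lambda>e. \<phi> (fst e ! j) (snd e ! j) (fst e ! Suc j)) \<le> 1"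
  using assms
proof (induction n arbitrary: h s j)
  case (Suc n)
  have t: "finite (set_pmf (trans M h s (\<pi> h s)))" "set_pmf (trans M h s (\<pi> h s)) \<subseteq> {..<S}"
    using Suc.prems trans_policy[of \<pi> h s] by auto
  show ?case
  proof (cases j)
    case 0
    have "E (run_from M \<pi> h (Suc n) s) (\<lambda>e. \<phi> (fst e ! j) (snd e ! j) (fst e ! Suc j)) =
        E (trans M h s (\<pi> h s)) (\<lambda>s'. E (run_from M \<pi> (Suc h) n s') (\<lambda>e. \<phi> s (\<pi> h s) (fst e ! 0)))"
      using Suc.prems 0 by (subst E_run_from_Suc) (auto simp: case_prod_unfold)
    also have "\<dots> = E (trans M h s (\<pi> h s)) (\<lambda>s'. E (run_from M \<pi> (Suc h) n s') (\<lambda>e. \<phi> s (\<pi> h s) s'))"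
      using Suc.prems t set_run_from(5)[OF Suc.prems(1), of "Suc h" n]
      by (intro E_cong) (force simp: subset_iff)
    finally show ?thesis using Suc.prems(4) Suc.prems(6)[of s] 0 by simp
  next
    case (Suc i)
    have "E (run_from M \<pi> h (Suc n) s) (\<lambda>e. \<phi> (fst e ! j) (snd e ! j) (fst e ! Suc j)) =
        E (trans M h s (\<pi> h s)) (\<lambda>s'. E (run_from M \<pi> (Suc h) n s')
          (\<lambda>e. \<phi> (fst e ! i) (snd e ! i) (fst e ! Suc i)))"
      using Suc.prems Suc by (subst E_run_from_Suc) (auto simp: case_prod_unfold)
    also have "\<dots> \<le> 1"
    proof (rule E_le_const[OF t(1)])
      fix s' assume "s' \<in> set_pmf (trans M h s (\<pi> h s))"
      then show "E (run_from M \<pi> (Suc h) n s') (\<lambda>e. \<phi> (fst e ! i) (snd e ! i) (fst e ! Suc i)) \<le> 1"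
        using t Suc.prems Suc by (intro Suc.IH) auto
    qed
    finally show ?thesis .
  qed
qed simp

section \<open>Exponential Bellman equations\<close>

text \<open>The Bellman operator of the entropic risk measure. It is nonlinear in \<open>v\<close>,
  but after exponentiation it becomes linear in \<open>exp (\<beta> * v s')\<close>.\<close>

definition backup :: "nat \<Rightarrow> nat \<Rightarrow> nat \<Rightarrow> (nat \<Rightarrow> real) \<Rightarrow> real" where
  "backup h s a v = rew M h s a + ln (E (trans M h s a) (\<lambda>s'. exp (\<beta> * v s'))) / \<beta>"

lemma exp_backup:
  assumes "1 \<le> h" "h \<le> H" "s < S" "a < A"
  shows "exp (\<beta> * backup h s a v) = exp (\<beta> * rew M h s a) * E (trans M h s a) (\<lambda>s'. exp (\<beta> * v s'))"
proof -
  have "0 < E (trans M h s a) (\<lambda>s'. exp (\<beta> * v s'))"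
    using finite_trans[OF assms] by (intro E_pos) auto
  then show ?thesis
    using beta by (simp add: backup_def ring_distribs exp_add)
qed

text \<open>For negative \<beta> the order is reversed twice, once by the exponential and once by
  the division by \<beta>.\<close>

lemma backup_mono:
  assumes "1 \<le> h" "h \<le> H" "s < S" "a < A" and le: "\<And>s'. s' < S \<Longrightarrow> v s' \<le> w s'"
  shows "backup h s a v \<le> backup h s a w"
proof -
  let ?E = "\<lambda>v. E (trans M h s a) (\<lambda>s'. exp (\<beta> * v s'))"
  note t = finite_trans[OF assms(1-4)] set_trans[OF assms(1-4)]
  have pos: "0 < ?E v" "0 < ?E w"
    using t by (auto intro!: E_pos)
  show ?thesis
  proof (cases "0 < \<beta>")
    case True
    then have "?E v \<le> ?E w" using t le by (intro E_mono) auto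
    then have "ln (?E v) \<le> ln (?E w)" using pos by simp
    then show ?thesis using True by (auto simp: backup_def divide_right_mono)
  next
    case False
    then have "?E w \<le> ?E v" using t le by (intro E_mono) (auto simp: mult_left_mono_neg)
    then have "ln (?E w) \<le> ln (?E v)" using pos by simp
    then show ?thesis using False by (auto simp: backup_def divide_right_mono_neg)
  qed
qed

lemma backup_const: "backup h s a (\<lambda>_. x) = rew M h s a + x"
  using beta by (simp add: backup_def)

lemma backup_cong:
  assumes "1 \<le> h" "h \<le> H" "s < S" "a < A" "\<And>s'. s' < S \<Longrightarrow> v s' = w s'"
  shows "backup h s a v = backup h s a w"
  using assms by (intro antisym backup_mono) auto

lemma backup_bounds:
  assumes "1 \<le> h" "h \<le> H" "s < S" "a < A" "\<And>s'. s' < S \<Longrightarrow> 0 \<le> v s' \<and> v s' \<le> x"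
  shows "0 \<le> backup h s a v" "backup h s a v \<le> 1 + x"
proof -
  show "0 \<le> backup h s a v"
    using backup_mono[of h s a "\<lambda>_. 0" v] assms rew_bounds[of h s a] by (auto simp: backup_const)
  show "backup h s a v \<le> 1 + x"
    using backup_mono[of h s a v "\<lambda>_. x"] assms rew_bounds[of h s a] by (auto simp: backup_const)
qed

lemma Vpi_terminal: "Vpi M \<beta> \<pi> (Suc H) s = 0"
  by (simp add: Vpi_def traj_reward_def)

text \<open>The exponential of the total reward is a product along the trajectory, so the factor of
  the first reward leaves the expectation and the rest is the exponentiated value of the next
  state.\<close>

lemma Vpi_backup:
  assumes "\<pi> \<in> policies M" "1 \<le> h" "h \<le> H" "s < S"
  shows "Vpi M \<beta> \<pi> h s = backup h s (\<pi> h s) (Vpi M \<beta> \<pi> (Suc h))"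
proof -
  let ?T = "trans M h s (\<pi> h s)" and ?n = "H - h"
  let ?F = "\<lambda>h n s. E (run_from M \<pi> h n s) (\<lambda>(ss, as). exp (\<beta> * traj_reward M h ss as))"
  have t: "finite (set_pmf ?T)" "set_pmf ?T \<subseteq> {..<S}"
    using assms trans_policy[of \<pi> h s] by auto
  have n: "H + 1 - h = Suc ?n" "H + 1 - Suc h = ?n" using assms by auto
  have pos: "0 < ?F (Suc h) ?n s'" if "s' \<in> set_pmf ?T" for s'
    using that t assms by (intro E_pos finite_run_from) auto
  have next_val: "exp (\<beta> * Vpi M \<beta> \<pi> (Suc h) s') = ?F (Suc h) ?n s'" if "s' \<in> set_pmf ?T" for s'
    using pos[OF that] beta n by (simp add: Vpi_def)
  have "?F h (Suc ?n) s = E ?T (\<lambda>s'. E (run_from M \<pi> (Suc h) ?n s')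
      (\<lambda>(ss, as). exp (\<beta> * rew M h s (\<pi> h s)) * exp (\<beta> * traj_reward M (Suc h) ss as)))"
    using assms by (subst E_run_from_Suc)
      (auto simp: traj_reward_path_sum path_sum_Cons ring_distribs exp_add)
  also have "\<dots> = exp (\<beta> * rew M h s (\<pi> h s)) * E ?T (\<lambda>s'. ?F (Suc h) ?n s')"
    by (simp add: case_prod_unfold)
  also have "E ?T (\<lambda>s'. ?F (Suc h) ?n s') = E ?T (\<lambda>s'. exp (\<beta> * Vpi M \<beta> \<pi> (Suc h) s'))"
    by (intro E_cong) (simp add: next_val)
  also have "exp (\<beta> * rew M h s (\<pi> h s)) * \<dots> = exp (\<beta> * backup h s (\<pi> h s) (Vpi M \<beta> \<pi> (Suc h)))"
    using assms policyD by (subst exp_backup) auto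
  finally show ?thesis
    unfolding Vpi_def[of M \<beta> \<pi> h] n using beta by simp
qed

lemma Qpi_backup:
  assumes "\<pi> \<in> policies M" "1 \<le> h" "h \<le> H" "s < S" "a < A"
  shows "Qpi M \<beta> \<pi> h s a = backup h s a (Vpi M \<beta> \<pi> (Suc h))"
proof -
  let ?\<pi> = "\<pi>(h := (\<pi> h)(s := a))"
  have "?\<pi> \<in> policies M" using assms by (auto simp: policies_def)
  moreover have "Vpi M \<beta> ?\<pi> (Suc h) = Vpi M \<beta> \<pi> (Suc h)"
    using run_from_cong[of "Suc h" ?\<pi> \<pi> M] by (auto simp: Vpi_def fun_eq_iff)
  ultimately show ?thesis
    unfolding Qpi_def using assms by (subst Vpi_backup) auto
qed

section \<open>Optimal values and an optimal policy by backward induction\<close>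

primrec vopt :: "nat \<Rightarrow> nat \<Rightarrow> real" where
  "vopt 0 s = 0"
| "vopt (Suc d) s = Max ((\<lambda>a. backup (H - d) s a (vopt d)) ` {..<A})"

text \<open>The explicit witness that the supremum in \<open>Vstar\<close> is attained.
  \<open>vopt\<close> counts the remaining steps, as \<open>Valg\<close> does, so step
  \<open>h\<close> looks ahead to \<open>vopt (H - h)\<close>.\<close>

definition greedy :: "nat \<Rightarrow> nat \<Rightarrow> nat" where
  "greedy h s = (SOME a. a < A \<and> (\<forall>a'<A. backup h s a' (vopt (H - h)) \<le> backup h s a (vopt (H - h))))"

lemma ex_argmax: "\<exists>a. a < A \<and> (\<forall>a'<A. f a' \<le> (f a :: real))"
proof -
  have "Max (f ` {..<A}) \<in> f ` {..<A}"
    using A_pos by (intro Max_in) (auto simp: lessThan_empty_iff)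
  then obtain a where "a < A" "Max (f ` {..<A}) = f a" by auto
  moreover have "f a' \<le> Max (f ` {..<A})" if "a' < A" for a'
    using that by (intro Max_ge) auto
  ultimately show ?thesis by metis
qed

lemma Max_eqI_argmax:
  "a < A \<Longrightarrow> (\<And>a'. a' < A \<Longrightarrow> f a' \<le> (f a :: real)) \<Longrightarrow> Max (f ` {..<A}) = f a"
  by (intro Max_eqI) auto

lemma greedy:
  shows "greedy h s < A"
    and "a' < A \<Longrightarrow> backup h s a' (vopt (H - h)) \<le> backup h s (greedy h s) (vopt (H - h))"
  using someI_ex[OF ex_argmax[of "\<lambda>a. backup h s a (vopt (H - h))"]]
  unfolding greedy_def[symmetric] by blast+

lemma greedy_policy: "greedy \<in> policies M"
  by (simp add: policies_def greedy)

lemma vopt_greedy: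
  assumes "d < H"
  shows "vopt (Suc d) s = backup (H - d) s (greedy (H - d) s) (vopt d)"
  using assms greedy(2)[of _ "H - d" s] greedy(1)[of "H - d" s]
  by (auto intro!: Max_eqI_argmax)

lemma Vpi_greedy: "d \<le> H \<Longrightarrow> s < S \<Longrightarrow> Vpi M \<beta> greedy (Suc H - d) s = vopt d s"
proof (induction d arbitrary: s)
  case (Suc d)
  have "Suc H - Suc d = H - d" "Suc (H - d) = Suc H - d" using Suc.prems by auto
  then show ?case
    using Suc greedy_policy greedy(1) Vpi_backup[of greedy "H - d" s] vopt_greedy[of d s]
    by (auto intro!: backup_cong)
qed (simp add: Vpi_terminal)

lemma Vpi_le_vopt:
  "\<pi> \<in> policies M \<Longrightarrow> d \<le> H \<Longrightarrow> s < S \<Longrightarrow> Vpi M \<beta> \<pi> (Suc H - d) s \<le> vopt d s"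
proof (induction d arbitrary: s)
  case (Suc d)
  have h: "Suc H - Suc d = H - d" "Suc (H - d) = Suc H - d" using Suc.prems by auto
  then have "Vpi M \<beta> \<pi> (Suc H - Suc d) s = backup (H - d) s (\<pi> (H - d) s) (Vpi M \<beta> \<pi> (Suc H - d))"
    using Suc Vpi_backup[of \<pi> "H - d" s] by auto
  also have "\<dots> \<le> backup (H - d) s (\<pi> (H - d) s) (vopt d)"
    using Suc policyD by (intro backup_mono) auto
  also have "\<dots> \<le> vopt (Suc d) s"
    using Suc.prems policyD by auto
  finally show ?case .
qed (simp add: Vpi_terminal)

lemma Vstar_vopt:
  assumes "d \<le> H" "s < S"
  shows "Vstar M \<beta> (Suc H - d) s = vopt d s"
  unfolding Vstar_def
proof (intro cSup_eq_maximum)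
  show "vopt d s \<in> (\<lambda>\<pi>. Vpi M \<beta> \<pi> (Suc H - d) s) ` policies M"
    using Vpi_greedy[OF assms] greedy_policy by (metis image_eqI)
qed (use Vpi_le_vopt assms in auto)

lemma ex_optimal_policy: "\<exists>\<pi>. optimal_policy M \<beta> \<pi>"
proof (intro exI[of _ greedy])
  have "Vpi M \<beta> greedy h s = Vstar M \<beta> h s" if "h \<in> {1..H + 1}" "s < S" for h s
    using that Vstar_vopt[of "Suc H - h" s] Vpi_greedy[of "Suc H - h" s] by auto
  then show "optimal_policy M \<beta> greedy"
    by (simp add: optimal_policy_def greedy_policy)
qed

text \<open>The value does not depend on which optimal policy the choice operator returns, because
  all of them have the value \<open>Vstar\<close> at step \<open>Suc h\<close>.\<close>

lemma Qstar_backup: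
  assumes "1 \<le> h" "h \<le> H" "s < S" "a < A"
  shows "Qstar M \<beta> h s a = backup h s a (Vstar M \<beta> (Suc h))"
proof -
  define \<pi> where "\<pi> = (SOME \<pi>. optimal_policy M \<beta> \<pi>)"
  have "optimal_policy M \<beta> \<pi>"
    unfolding \<pi>_def using ex_optimal_policy by (rule someI_ex)
  then show ?thesis
    unfolding Qstar_def \<pi>_def[symmetric] using assms
    by (auto simp: Qpi_backup optimal_policy_def intro!: backup_cong)
qed

lemma Vstar_terminal: "s < S \<Longrightarrow> Vstar M \<beta> (Suc H) s = 0"
  using Vstar_vopt[of 0 s] by simp

lemma Vstar_Max_Qstar:
  assumes "1 \<le> h" "h \<le> H" "s < S"
  shows "Vstar M \<beta> h s = Max (Qstar M \<beta> h s ` {..<A})"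
proof -
  have "Vstar M \<beta> h s = Max ((\<lambda>a. backup h s a (vopt (H - h))) ` {..<A})"
    using assms Vstar_vopt[of "Suc (H - h)" s] by simp
  also have "(\<lambda>a. backup h s a (vopt (H - h))) ` {..<A} = Qstar M \<beta> h s ` {..<A}"
    using assms Vstar_vopt[of "H - h"]
    by (intro image_cong) (auto simp: Qstar_backup Suc_diff_le intro!: backup_cong)
  finally show ?thesis .
qed

lemma Qstar_le_Vstar:
  assumes "1 \<le> h" "h \<le> H" "s < S" "a < A"
  shows "Qstar M \<beta> h s a \<le> Vstar M \<beta> h s"
  using assms by (simp add: Vstar_Max_Qstar)

lemma Vstar_bounds:
  assumes "1 \<le> h" "h \<le> Suc H" "s < S"
  shows "0 \<le> Vstar M \<beta> h s" "Vstar M \<beta> h s \<le> real (Suc H - h)"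
proof -
  have "0 \<le> vopt d s \<and> vopt d s \<le> real d" if "d \<le> H" "s < S" for d s
    using that
  proof (induction d arbitrary: s)
    case (Suc d)
    show ?case
      using Suc backup_bounds[of "H - d" s "greedy (H - d) s" "vopt d" "real d"] greedy(1)
      by (auto simp: vopt_greedy simp del: vopt.simps)
  qed simp
  from this[of "Suc H - h" s] show "0 \<le> Vstar M \<beta> h s" "Vstar M \<beta> h s \<le> real (Suc H - h)"
    using assms Vstar_vopt[of "Suc H - h" s] by auto
qed

lemma Qstar_bounds:
  assumes "1 \<le> h" "h \<le> H" "s < S" "a < A"
  shows "0 \<le> Qstar M \<beta> h s a" "Qstar M \<beta> h s a \<le> real (H - h + 1)"
  using assms Qstar_backup[OF assms] Vstar_bounds[of "Suc h"]
    backup_bounds[of h s a "Vstar M \<beta> (Suc h)" "real (H - h)"] by auto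

lemma Vpi_le_Vstar:
  assumes "\<pi> \<in> policies M" "1 \<le> h" "h \<le> Suc H" "s < S"
  shows "Vpi M \<beta> \<pi> h s \<le> Vstar M \<beta> h s"
  using assms Vpi_le_vopt[of \<pi> "Suc H - h" s] Vstar_vopt[of "Suc H - h" s] by auto

lemma Vpi_nonneg:
  assumes "\<pi> \<in> policies M" "1 \<le> h" "h \<le> Suc H" "s < S"
  shows "0 \<le> Vpi M \<beta> \<pi> h s"
proof -
  have "0 \<le> Vpi M \<beta> \<pi> (Suc H - d) s" if "d \<le> H" "s < S" for d s
    using that
  proof (induction d arbitrary: s)
    case (Suc d)
    have h: "Suc H - Suc d = H - d" "Suc (H - d) = Suc H - d" using Suc.prems by auto
    have "0 \<le> backup (H - d) s (\<pi> (H - d) s) (Vpi M \<beta> \<pi> (Suc H - d))"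
    proof (rule order_trans)
      show "0 \<le> rew M (H - d) s (\<pi> (H - d) s)"
        using Suc.prems assms(1) policyD rew_bounds[of "H - d" s "\<pi> (H - d) s"] by auto
      show "rew M (H - d) s (\<pi> (H - d) s) \<le> backup (H - d) s (\<pi> (H - d) s) (Vpi M \<beta> \<pi> (Suc H - d))"
        using Suc assms(1) policyD
          backup_mono[of "H - d" s "\<pi> (H - d) s" "\<lambda>_. 0" "Vpi M \<beta> \<pi> (Suc H - d)"]
        by (auto simp: backup_const)
    qed
    then show ?case
      using Suc.prems h Vpi_backup[of \<pi> "H - d" s] assms(1) by auto
  qed (simp add: Vpi_terminal)
  from this[of "Suc H - h" s] show ?thesis using assms by auto
qed

end

section \<open>From set-wise deviations to bounded functions\<close>

text \<open>Equal masses allow \<open>u\<close> to be shifted by \<open>lo\<close>. The shifted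
  function is nonnegative and at most \<open>hi - lo\<close>, so the difference is largest when it
  is \<open>hi - lo\<close> exactly on the set where \<open>p\<close> dominates \<open>q\<close>,
  and that set is one of the admissible \<open>T\<close>.\<close>

lemma sum_diff_le_range_mult:
  fixes p q u :: "'a \<Rightarrow> real"
  assumes "finite X" "sum p X = sum q X" "\<And>T. T \<subseteq> X \<Longrightarrow> sum p T - sum q T \<le> \<epsilon>"
    and u: "\<And>x. x \<in> X \<Longrightarrow> lo \<le> u x \<and> u x \<le> hi" and "lo \<le> hi"
  shows "(\<Sum>x\<in>X. p x * u x) - (\<Sum>x\<in>X. q x * u x) \<le> (hi - lo) * \<epsilon>"
proof -
  define T where "T = {x\<in>X. q x \<le> p x}"
  have "(\<Sum>x\<in>X. p x * u x) - (\<Sum>x\<in>X. q x * u x) = (\<Sum>x\<in>X. (p x - q x) * (u x - lo)) + (sum p X - sum q X) * lo"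
    by (simp add: algebra_simps sum_subtractf sum.distrib sum_distrib_left sum_distrib_right)
  also have "\<dots> = (\<Sum>x\<in>X. (p x - q x) * (u x - lo))"
    using assms(2) by simp
  also have "\<dots> \<le> (\<Sum>x\<in>X. if q x \<le> p x then (p x - q x) * (hi - lo) else 0)"
    using u by (intro sum_mono) (auto intro!: mult_left_mono mult_nonpos_nonneg)
  also have "\<dots> = (hi - lo) * (sum p T - sum q T)"
    unfolding T_def using assms(1)
    by (simp add: sum.inter_filter[symmetric] sum_subtractf sum_distrib_left mult.commute right_diff_distrib)
  also have "\<dots> \<le> (hi - lo) * \<epsilon>"
    using assms by (intro mult_left_mono) (auto simp: T_def)
  finally show ?thesis .
qed

lemma abs_sum_diff_le_range_mult:
  fixes p q u :: "'a \<Rightarrow> real"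
  assumes "finite X" "sum p X = sum q X" "\<And>T. T \<subseteq> X \<Longrightarrow> sum p T - sum q T \<le> \<epsilon>"
    and u: "\<And>x. x \<in> X \<Longrightarrow> lo \<le> u x \<and> u x \<le> hi" and "lo \<le> hi"
  shows "\<bar>(\<Sum>x\<in>X. p x * u x) - (\<Sum>x\<in>X. q x * u x)\<bar> \<le> (hi - lo) * \<epsilon>"
  \<comment> \<open>Negating \<open>u\<close> turns the one-sided hypothesis on sets into the lower
    bound as well.\<close>
  using sum_diff_le_range_mult[of X p q \<epsilon> lo u hi] sum_diff_le_range_mult[of X p q \<epsilon> "-hi" "\<lambda>x. - u x" "-lo"] assms
  by (auto simp: sum_negf abs_le_iff)

section \<open>The risk weights\<close>

context risk_mdp
begin

lemma psi_pos_iff: "0 < psi \<beta> n \<longleftrightarrow> 0 < \<beta>" and psi_neg_iff: "psi \<beta> n < 0 \<longleftrightarrow> \<beta> < 0"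
  using beta by (auto simp: psi_def zero_less_divide_iff divide_less_0_iff)

text \<open>\<open>psi\<close> has the sign of \<beta>, so the weighted exponential is increasing in
  either regime; this allows most later arguments to treat both signs at once.\<close>

lemma psi_exp_le_iff: "psi \<beta> n * exp (\<beta> * x) \<le> psi \<beta> n * exp (\<beta> * y) \<longleftrightarrow> x \<le> y"
  using beta psi_pos_iff[of n] psi_neg_iff[of n]
  by (cases "0 < \<beta>") (auto simp: mult_le_cancel_left)

lemma weighted_diff_mono:
  assumes "x \<le> x'" "y' \<le> y"
  shows "psi \<beta> n * exp r * (exp (\<beta> * x) - exp (\<beta> * y)) \<le> psi \<beta> n * exp r * (exp (\<beta> * x') - exp (\<beta> * y'))"
proof -
  have "psi \<beta> n * (exp (\<beta> * x) - exp (\<beta> * y)) \<le> psi \<beta> n * (exp (\<beta> * x') - exp (\<beta> * y'))"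
    unfolding right_diff_distrib using assms psi_exp_le_iff[of n x x'] psi_exp_le_iff[of n y' y]
    by (intro diff_mono) simp_all
  then have "exp r * (psi \<beta> n * (exp (\<beta> * x) - exp (\<beta> * y))) \<le>
      exp r * (psi \<beta> n * (exp (\<beta> * x') - exp (\<beta> * y')))"
    by (rule mult_left_mono) simp
  then show ?thesis by (simp only: mult_ac)
qed

definition scale :: real where
  "scale = (exp (\<bar>\<beta>\<bar> * real H) - 1) / \<bar>\<beta>\<bar>"

lemma scale_ge: "real H \<le> scale"
proof -
  have "1 + \<bar>\<beta>\<bar> * real H \<le> exp (\<bar>\<beta>\<bar> * real H)" by (rule exp_ge_add_one_self)
  then show ?thesis using beta by (simp add: scale_def field_simps)
qed

lemma scale_ge_1: "1 \<le> scale"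
  using scale_ge H_pos by linarith

text \<open>For positive \<beta> the two exponents add up to at most \<beta> times \<open>H\<close>.
  For negative \<beta> both remaining factors are monotone, and the factor
  \<open>exp (- \<beta> * real H)\<close> inside \<open>psi\<close> turns
  \<open>1 - exp (\<beta> * real H)\<close> into the numerator of \<open>scale\<close>.\<close>

lemma psi_weight_le_scale:
  assumes "1 \<le> h" "h \<le> H" "0 \<le> R" "R \<le> real (h - 1)"
  shows "\<bar>psi \<beta> H\<bar> * exp (\<beta> * R) * \<bar>exp (\<beta> * real (H - h + 1)) - 1\<bar> \<le> scale"
proof (cases "0 < \<beta>")
  case True
  have "exp (\<beta> * R) * (exp (\<beta> * real (H - h + 1)) - 1) = exp (\<beta> * (R + real (H - h + 1))) - exp (\<beta> * R)"
    by (simp add: algebra_simps exp_add)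
  also have "\<dots> \<le> exp (\<beta> * real H) - 1"
  proof (rule diff_mono)
    have "R + real (H - h + 1) \<le> real H" using assms by linarith
    then show "exp (\<beta> * (R + real (H - h + 1))) \<le> exp (\<beta> * real H)" using True by simp
    show "1 \<le> exp (\<beta> * R)" using True assms by simp
  qed
  finally show ?thesis
    using True by (simp add: psi_def scale_def divide_right_mono)
next
  case False
  have "exp (\<beta> * R) * (1 - exp (\<beta> * real (H - h + 1))) \<le> 1 * (1 - exp (\<beta> * real H))"
    using False assms by (intro mult_mono) (auto simp: mult_nonpos_nonneg mult_left_mono_neg)
  then have "exp (- \<beta> * real H) * (exp (\<beta> * R) * (1 - exp (\<beta> * real (H - h + 1)))) \<le>
      exp (- \<beta> * real H) * (1 - exp (\<beta> * real H))"
    by (intro mult_left_mono) auto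
  also have "\<dots> = exp (- \<beta> * real H) - 1"
    by (simp add: right_diff_distrib flip: exp_add)
  finally have "exp (- \<beta> * real H) * (exp (\<beta> * R) * (1 - exp (\<beta> * real (H - h + 1)))) / (- \<beta>) \<le>
      (exp (- \<beta> * real H) - 1) / (- \<beta>)"
    using False by (intro divide_right_mono) auto
  moreover have "\<bar>exp (\<beta> * real (H - h + 1)) - 1\<bar> = 1 - exp (\<beta> * real (H - h + 1))"
    using False by (simp add: mult_nonpos_nonneg)
  moreover have "\<bar>psi \<beta> H\<bar> = exp (- \<beta> * real H) / (- \<beta>)" "\<bar>\<beta>\<bar> = - \<beta>"
    using False by (simp_all add: psi_def)
  ultimately show ?thesis by (simp only: scale_def) simp
qed

lemma psi_exp_diff_le_scale:
  assumes "1 \<le> h" "h \<le> H" "0 \<le> R" "R \<le> real (h - 1)"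
    and "0 \<le> x" "x \<le> real (H - h + 1)" "0 \<le> y" "y \<le> real (H - h + 1)"
  shows "psi \<beta> H * exp (\<beta> * R) * (exp (\<beta> * x) - exp (\<beta> * y)) \<le> scale"
proof -
  let ?m = "real (H - h + 1)"
  have "psi \<beta> H * (exp (\<beta> * x) - exp (\<beta> * y)) \<le> psi \<beta> H * (exp (\<beta> * ?m) - exp (\<beta> * 0))"
    using psi_exp_le_iff[of H x ?m] psi_exp_le_iff[of H 0 y] assms by (simp add: right_diff_distrib)
  also have "\<dots> \<le> \<bar>psi \<beta> H\<bar> * \<bar>exp (\<beta> * ?m) - 1\<bar>"
    using abs_ge_self[of "psi \<beta> H * (exp (\<beta> * ?m) - exp (\<beta> * 0))"] by (simp add: abs_mult)
  finally have "exp (\<beta> * R) * (psi \<beta> H * (exp (\<beta> * x) - exp (\<beta> * y))) \<le>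
      exp (\<beta> * R) * (\<bar>psi \<beta> H\<bar> * \<bar>exp (\<beta> * ?m) - 1\<bar>)"
    by (intro mult_left_mono) auto
  also have "\<dots> = \<bar>psi \<beta> H\<bar> * exp (\<beta> * R) * \<bar>exp (\<beta> * ?m) - 1\<bar>"
    by (simp only: mult_ac)
  also have "\<dots> \<le> scale"
    by (rule psi_weight_le_scale[OF assms(1-4)])
  finally show ?thesis by (simp only: mult_ac)
qed

text \<open>The normalisation in \<open>psi\<close> makes the slope of the weighted exponential at
  least one on the interval from 0 to \<open>H\<close>; the proof uses
  \<open>1 + t \<le> exp t\<close>. Regret is thereby converted into weighted differences of
  exponentials.\<close>

lemma diff_le_psi_exp_diff:
  assumes "0 \<le> y" "y \<le> x" "x \<le> real H"
  shows "x - y \<le> psi \<beta> H * (exp (\<beta> * x) - exp (\<beta> * y))"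
proof (cases "0 < \<beta>")
  case True
  have "exp (\<beta> * y) * (1 + \<beta> * (x - y)) \<le> exp (\<beta> * y) * exp (\<beta> * (x - y))"
    by (intro mult_left_mono exp_ge_add_one_self) auto
  then have "exp (\<beta> * y) * (\<beta> * (x - y)) \<le> exp (\<beta> * x) - exp (\<beta> * y)"
    by (simp add: algebra_simps flip: exp_add)
  moreover have "1 * (\<beta> * (x - y)) \<le> exp (\<beta> * y) * (\<beta> * (x - y))"
    using True assms by (intro mult_right_mono) auto
  ultimately show ?thesis
    using True by (simp add: psi_def field_simps)
next
  case False
  define b where "b = - \<beta>"
  have b: "0 < b" using False beta by (simp add: b_def)
  have "exp (b * (H - x)) * (1 + b * (x - y)) \<le> exp (b * (H - x)) * exp (b * (x - y))"
    by (intro mult_left_mono exp_ge_add_one_self) auto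
  then have "exp (b * (H - x)) * (b * (x - y)) \<le> exp (b * H) * (exp (- b * y) - exp (- b * x))"
    by (simp add: algebra_simps flip: exp_add)
  moreover have "1 * (b * (x - y)) \<le> exp (b * (H - x)) * (b * (x - y))"
    using b assms by (intro mult_right_mono) auto
  ultimately have "b * (x - y) \<le> exp (b * H) * (exp (- b * y) - exp (- b * x))"
    by linarith
  then have "x - y \<le> exp (b * H) * (exp (- b * y) - exp (- b * x)) / b"
    using b by (simp add: field_simps)
  also have "\<dots> = psi \<beta> H * (exp (\<beta> * x) - exp (\<beta> * y))"
    using False by (simp add: psi_def b_def right_diff_distrib diff_divide_distrib)
  finally show ?thesis .
qed

section \<open>Trajectory prefixes and the minimal gap\<close>

definition valid_prefix :: "(nat \<times> nat) list \<Rightarrow> bool" where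
  "valid_prefix \<tau> \<longleftrightarrow> length \<tau> = H \<and> set \<tau> \<subseteq> {..<S} \<times> {..<A}"

lemma valid_prefix_update:
  "valid_prefix \<tau> \<Longrightarrow> s < S \<Longrightarrow> a < A \<Longrightarrow> valid_prefix (\<tau>[j := (s, a)])"
  using set_update_subset_insert[of \<tau> j "(s, a)"] by (auto simp: valid_prefix_def)

lemma ex_valid_prefix: "\<exists>\<tau>. valid_prefix \<tau>"
  using S_pos A_pos by (intro exI[of _ "replicate H (0, 0)"]) (auto simp: valid_prefix_def)

lemma prefix_reward_bounds:
  assumes "valid_prefix \<tau>" "h \<le> Suc H"
  shows "0 \<le> prefix_reward M \<tau> h" "prefix_reward M \<tau> h \<le> real (h - 1)"
proof -
  have *: "0 \<le> rew M (Suc j) (fst (\<tau> ! j)) (snd (\<tau> ! j)) \<and> rew M (Suc j) (fst (\<tau> ! j)) (snd (\<tau> ! j)) \<le> 1"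
    if "j < h - 1" for j
  proof -
    have "\<tau> ! j \<in> set \<tau>" using that assms by (auto simp: valid_prefix_def)
    then have "\<tau> ! j \<in> {..<S} \<times> {..<A}" using assms by (auto simp only: valid_prefix_def)
    then show ?thesis using that assms by (intro rew_bounds) auto
  qed
  then show "0 \<le> prefix_reward M \<tau> h"
    unfolding prefix_reward_def by (intro sum_nonneg) auto
  have "prefix_reward M \<tau> h \<le> (\<Sum>j<h - 1. 1)"
    unfolding prefix_reward_def using * by (intro sum_mono) auto
  then show "prefix_reward M \<tau> h \<le> real (h - 1)" by simp
qed

text \<open>Overwriting entry \<open>h - 1\<close> appends the pair played at step \<open>h\<close>
  to the prefix while the list keeps length \<open>H\<close>. The factor
  \<open>exp (\<beta> * rew M h s a)\<close> of a backup is thus absorbed into the weight of the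
  next step.\<close>

lemma prefix_reward_update:
  assumes "valid_prefix \<tau>" "1 \<le> h" "h \<le> H"
  shows "prefix_reward M (\<tau>[h - 1 := (s, a)]) (Suc h) = prefix_reward M \<tau> h + rew M h s a"
proof -
  obtain i where i: "h = Suc i" using assms by (cases h) auto
  have "(\<Sum>j<i. rew M (Suc j) (fst (\<tau>[i := (s, a)] ! j)) (snd (\<tau>[i := (s, a)] ! j))) =
      (\<Sum>j<i. rew M (Suc j) (fst (\<tau> ! j)) (snd (\<tau> ! j)))"
    by (intro sum.cong) auto
  then show ?thesis
    using assms i by (simp add: prefix_reward_def valid_prefix_def)
qed

lemma prefix_reward_1 [simp]: "prefix_reward M \<tau> (Suc 0) = 0"
  by (simp add: prefix_reward_def)

lemma gap_le_scale:
  assumes "valid_prefix \<tau>" "1 \<le> h" "h \<le> H" "s < S" "a < A"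
  shows "gap M \<beta> h s a \<tau> \<le> scale"
  unfolding gap_def
  using assms prefix_reward_bounds[of \<tau> h] Vstar_bounds[of h s] Qstar_bounds[of h s a]
  by (intro psi_exp_diff_le_scale) (auto simp: Suc_diff_le)

lemma finite_gap_set: "finite (gap_set M \<beta>)"
proof (rule finite_subset)
  let ?L = "{\<tau>. set \<tau> \<subseteq> {..<S} \<times> {..<A} \<and> length \<tau> = H}"
  show "gap_set M \<beta> \<subseteq> (\<lambda>(h, s, a, \<tau>). gap M \<beta> h s a \<tau>) ` ({1..H} \<times> {..<S} \<times> {..<A} \<times> ?L)"
  proof
    fix x assume "x \<in> gap_set M \<beta>"
    then obtain h s a \<tau> where "x = gap M \<beta> h s a \<tau>"
      and "(h, s, a, \<tau>) \<in> {1..H} \<times> {..<S} \<times> {..<A} \<times> ?L"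
      unfolding gap_set_def by blast
    then show "x \<in> (\<lambda>(h, s, a, \<tau>). gap M \<beta> h s a \<tau>) ` ({1..H} \<times> {..<S} \<times> {..<A} \<times> ?L)"
      by (intro image_eqI[of _ _ "(h, s, a, \<tau>)"]) auto
  qed
  show "finite ((\<lambda>(h, s, a, \<tau>). gap M \<beta> h s a \<tau>) ` ({1..H} \<times> {..<S} \<times> {..<A} \<times> ?L))"
    by (intro finite_imageI finite_cartesian_product finite_lists_length_eq) auto
qed

lemma Delta_min_le_gap:
  assumes "valid_prefix \<tau>" "1 \<le> h" "h \<le> H" "s < S" "a < A" "gap M \<beta> h s a \<tau> \<noteq> 0"
  shows "Delta_min M \<beta> \<le> gap M \<beta> h s a \<tau>"
proof -
  have "gap M \<beta> h s a \<tau> \<in> gap_set M \<beta>"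
    unfolding gap_set_def using assms by (auto simp: valid_prefix_def)
  then show ?thesis
    unfolding Delta_min_def by (rule Min_le[OF finite_gap_set])
qed

end

section \<open>One planning step of the algorithm\<close>

text \<open>The constant of the exploration bonus is fixed to 2 in the abbreviations below.
  Nonemptiness of the gap set makes \<open>Delta_min\<close> a genuine minimum and later forces at
  least two actions.\<close>

locale rsvi2 = risk_mdp +
  fixes K :: nat and \<delta> :: real
  assumes K_pos: "1 \<le> K" and delta_pos: "0 < \<delta>" and delta_le: "\<delta> \<le> 1"
    and gaps: "gap_set M \<beta> \<noteq> {}" and Delta_pos: "0 < Delta_min M \<beta>"
begin

abbreviation V where "V D d \<equiv> Valg M \<beta> 2 K \<delta> D d"
abbreviation pol where "pol D \<equiv> alg_policy M \<beta> 2 K \<delta> D"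
abbreviation qstep where "qstep D h v s a \<equiv> Qalg_step M \<beta> 2 K \<delta> D h v s a"

definition iota :: real where
  "iota = ln (2 * real S * real A * real H * real K / \<delta>)"

definition radius :: "nat \<Rightarrow> real" where
  "radius n = sqrt (real S * iota / real n)"

lemma SAHK_ge: "1 \<le> real S * real A * real H * real K"
  using S_pos A_pos H_pos K_pos by (simp add: Suc_le_eq flip: of_nat_mult)

lemma iota_ge: "ln 2 \<le> iota"
proof -
  have "2 * \<delta> \<le> 2 * 1" "2 * 1 \<le> 2 * (real S * real A * real H * real K)"
    using delta_le SAHK_ge by (intro mult_left_mono; simp)+
  then have "2 \<le> 2 * real S * real A * real H * real K / \<delta>"
    using delta_pos by (simp add: field_simps)
  then show ?thesis unfolding iota_def by simp
qed

lemma iota_pos: "0 < iota"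
  using iota_ge ln_gt_zero[of "2 :: real"] by linarith

lemma radius_nonneg: "0 \<le> radius n"
  using iota_pos by (simp add: radius_def)

section \<open>Histories and transition counts\<close>

definition valid_episode :: "episode \<Rightarrow> bool" where
  "valid_episode e \<longleftrightarrow> length (fst e) = Suc H \<and> length (snd e) = H \<and>
     set (fst e) \<subseteq> {..<S} \<and> set (snd e) \<subseteq> {..<A}"

lemma st_less: "valid_episode e \<Longrightarrow> 1 \<le> h \<Longrightarrow> h \<le> Suc H \<Longrightarrow> st e h < S"
  by (cases h) (auto simp: valid_episode_def st_def subset_iff)

lemma ac_less: "valid_episode e \<Longrightarrow> 1 \<le> h \<Longrightarrow> h \<le> H \<Longrightarrow> ac e h < A"
  by (cases h) (auto simp: valid_episode_def ac_def subset_iff)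

definition valid_hist :: "episode list \<Rightarrow> bool" where
  "valid_hist D \<longleftrightarrow> (\<forall>e\<in>set D. valid_episode e)"

definition hits :: "episode list \<Rightarrow> nat \<Rightarrow> nat \<Rightarrow> nat \<Rightarrow> nat set \<Rightarrow> nat" where
  "hits D h s a T = length (filter (\<lambda>e. st e h = s \<and> ac e h = a \<and> st e (Suc h) \<in> T) D)"

lemma hits_eq_sum: "finite T \<Longrightarrow> hits D h s a T = (\<Sum>x\<in>T. hits D h s a {x})"
proof (induction D)
  case (Cons e D)
  have "(\<Sum>x\<in>T. hits (e # D) h s a {x}) = (\<Sum>x\<in>T. hits D h s a {x}) +
      (\<Sum>x\<in>T. if st e (Suc h) = x then (if st e h = s \<and> ac e h = a then 1 else 0) else 0)"
    unfolding sum.distrib[symmetric] by (intro sum.cong) (auto simp: hits_def)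
  then show ?case using Cons by (auto simp: hits_def)
qed (simp add: hits_def)

lemma hits_UNIV:
  "valid_hist D \<Longrightarrow> 1 \<le> h \<Longrightarrow> h \<le> H \<Longrightarrow> hits D h s a {..<S} = cnt D h s a"
  unfolding hits_def cnt_def valid_hist_def
  by (intro arg_cong[where f = length] filter_cong) (auto simp: st_less)

lemma sum_list_eq_sum_hits:
  assumes "valid_hist D" "1 \<le> h" "h \<le> H"
  shows "sum_list (map (\<lambda>e. if st e h = s \<and> ac e h = a then u (st e (h + 1)) else 0) D) =
    (\<Sum>x<S. real (hits D h s a {x}) * u x)"
  using assms(1)
proof (induction D)
  case (Cons e D)
  have st: "st e (Suc h) < S" using Cons.prems assms by (auto simp: valid_hist_def intro: st_less)
  have "(\<Sum>x<S. real (hits (e # D) h s a {x}) * u x) = (\<Sum>x<S. real (hits D h s a {x}) * u x) +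
      (\<Sum>x<S. if st e (Suc h) = x then (if st e h = s \<and> ac e h = a then u x else 0) else 0)"
    unfolding sum.distrib[symmetric] by (intro sum.cong) (auto simp: hits_def algebra_simps)
  then show ?case using Cons st by (auto simp: valid_hist_def)
qed (simp add: hits_def)

text \<open>Uniformity over successor sets is essential: the planned values depend on the same data,
  so no single function could be fixed in advance. The factor \<open>S\<close> under the root in
  \<open>radius\<close> pays for the \<open>2 ^ S\<close> sets.\<close>

definition concentrated :: "episode list \<Rightarrow> nat \<Rightarrow> nat \<Rightarrow> nat \<Rightarrow> bool" where
  "concentrated D h s a \<longleftrightarrow> (\<forall>T\<subseteq>{..<S}. real (hits D h s a T) -
     real (cnt D h s a) * measure_pmf.prob (trans M h s a) T \<le>
     real (cnt D h s a) * (2 * radius (cnt D h s a)))"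

definition good :: "episode list \<Rightarrow> bool" where
  "good D \<longleftrightarrow> valid_hist D \<and>
     (\<forall>h\<in>{1..H}. \<forall>s<S. \<forall>a<A. 1 \<le> cnt D h s a \<longrightarrow> concentrated D h s a)"

text \<open>Here \<open>v\<close> is an arbitrary function with the range of a value at step
  \<open>h + 1\<close>, so the results apply to the data-dependent values of the algorithm.\<close>

context
  fixes D h s a v
  assumes valid: "valid_hist D" and h: "1 \<le> h" "h \<le> H" and s: "s < S" and a: "a < A"
    and v: "\<And>s'. s' < S \<Longrightarrow> 0 \<le> v s' \<and> v s' \<le> real (H - h)"
begin

private abbreviation n where "n \<equiv> cnt D h s a"
private abbreviation m where "m \<equiv> real (H - h + 1)"
private definition u where "u x = exp (\<beta> * (rew M h s a + v x))" for x
private definition w where "w = (\<Sum>x<S. real (hits D h s a {x}) / real n * u x)"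
private definition b where "b = 2 * \<bar>exp (\<beta> * m) - 1\<bar> * radius n"

private lemma u_range:
  assumes "x < S"
  shows "0 < \<beta> \<Longrightarrow> 1 \<le> u x" "\<beta> < 0 \<Longrightarrow> u x \<le> 1"
    "min 1 (exp (\<beta> * m)) \<le> u x" "u x \<le> max 1 (exp (\<beta> * m))"
proof -
  have r: "0 \<le> rew M h s a + v x" "rew M h s a + v x \<le> m"
    using v[OF assms] rew_bounds[OF h s a] by auto
  then show "0 < \<beta> \<Longrightarrow> 1 \<le> u x" "\<beta> < 0 \<Longrightarrow> u x \<le> 1"
    by (auto simp: u_def mult_nonpos_nonneg)
  show "min 1 (exp (\<beta> * m)) \<le> u x" "u x \<le> max 1 (exp (\<beta> * m))"
    using r beta by (cases "0 < \<beta>"; auto simp: u_def min_le_iff_disj le_max_iff_disj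
      mult_nonpos_nonneg mult_left_mono_neg)+
qed

private lemma sum_freq:
  assumes "1 \<le> n"
  shows "(\<Sum>x<S. real (hits D h s a {x}) / real n) = 1"
proof -
  have "(\<Sum>x<S. real (hits D h s a {x})) = real n"
    using hits_UNIV[OF valid h, of s a] hits_eq_sum[of "{..<S}" D h s a] by (simp flip: of_nat_sum)
  then show ?thesis using assms by (simp flip: sum_divide_distrib)
qed

private lemma w_range:
  assumes "1 \<le> n"
  shows "0 < \<beta> \<Longrightarrow> 1 \<le> w" "\<beta> < 0 \<Longrightarrow> w \<le> 1"
proof -
  show "1 \<le> w" if "0 < \<beta>"
    unfolding w_def sum_freq[OF assms, symmetric] using u_range(1)[OF _ that]
    by (intro sum_mono) (auto intro!: divide_right_mono simp: mult_le_cancel_left1)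
  show "w \<le> 1" if "\<beta> < 0"
    unfolding w_def sum_freq[OF assms, symmetric] using u_range(2)[OF _ that]
    by (intro sum_mono) (auto intro!: divide_right_mono simp: mult_le_cancel_left2)
qed

private lemma b_nonneg: "0 \<le> b"
  by (simp add: b_def radius_nonneg)

private lemma qstep_eq:
  assumes "1 \<le> n"
  shows "qstep D h v s a = ln (if 0 < \<beta> then min (exp (\<beta> * m)) (w + b) else max (exp (\<beta> * m)) (w - b)) / \<beta>"
proof -
  have "sum_list (map (\<lambda>e. if st e h = s \<and> ac e h = a
      then exp (\<beta> * (rew M h s a + v (st e (h + 1)))) else 0) D) / real n = w"
    using sum_list_eq_sum_hits[OF valid h, of s a u]
    unfolding w_def u_def by (simp add: sum_divide_distrib)
  then show ?thesis
    using assms unfolding Qalg_step_def by (simp add: Let_def b_def radius_def iota_def)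
qed

text \<open>The logarithm can be undone because its argument is positive: for positive \<beta> since
  \<open>w\<close> is at least 1, for negative \<beta> since the maximum includes an
  exponential.\<close>

private lemma exp_qstep:
  assumes "1 \<le> n"
  shows "exp (\<beta> * qstep D h v s a) =
    (if 0 < \<beta> then min (exp (\<beta> * m)) (w + b) else max (exp (\<beta> * m)) (w - b))" (is "_ = ?G")
proof -
  have "0 < ?G" using w_range[OF assms] b_nonneg by (auto simp: less_max_iff_disj)
  then show ?thesis unfolding qstep_eq[OF assms] using beta by simp
qed

text \<open>One bound comes from the truncation at \<open>exp (\<beta> * m)\<close>. The other holds
  because \<open>w\<close> lies on the correct side of 1 and the bonus moves it further to that
  side.\<close>

lemma qstep_bounds: "0 \<le> qstep D h v s a" "qstep D h v s a \<le> m"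
proof -
  have "0 \<le> qstep D h v s a \<and> qstep D h v s a \<le> m"
  proof (cases "n = 0")
    case True
    then show ?thesis by (simp add: Qalg_step_def)
  next
    case False
    then have n: "1 \<le> n" by simp
    show ?thesis
    proof (cases "0 < \<beta>")
      case True
      then have "1 \<le> exp (\<beta> * qstep D h v s a)" "exp (\<beta> * qstep D h v s a) \<le> exp (\<beta> * m)"
        using exp_qstep[OF n] w_range[OF n] b_nonneg by auto
      then show ?thesis using True by (simp add: zero_le_mult_iff)
    next
      case neg: False
      then have "exp (\<beta> * qstep D h v s a) \<le> 1" "exp (\<beta> * m) \<le> exp (\<beta> * qstep D h v s a)"
        using exp_qstep[OF n] w_range[OF n] b_nonneg beta by (auto simp: mult_nonpos_nonneg)
      then show ?thesis using neg beta by (simp add: mult_le_0_iff)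
    qed
  qed
  then show "0 \<le> qstep D h v s a" "qstep D h v s a \<le> m" by auto
qed

context
  assumes conc: "1 \<le> n \<longrightarrow> concentrated D h s a"
begin

text \<open>The empirical frequencies and the kernel differ by at most \<open>2 * radius n\<close>
  on every set, and \<open>u\<close> ranges over an interval of length
  \<open>\<bar>exp (\<beta> * m) - 1\<bar>\<close>. The product is exactly the bonus, which explains
  the constant 2 in the algorithm.\<close>

private lemma w_close:
  assumes n: "1 \<le> n"
  shows "\<bar>w - exp (\<beta> * backup h s a v)\<bar> \<le> b"
proof -
  have "exp (\<beta> * backup h s a v) = (\<Sum>x<S. pmf (trans M h s a) x * u x)"
    unfolding exp_backup[OF h s a] using set_trans[OF h s a]
    by (subst E_sum_pmf[of "{..<S}"]) (auto simp: sum_distrib_left u_def ring_distribs exp_add mult_ac)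
  moreover have "\<bar>w - (\<Sum>x<S. pmf (trans M h s a) x * u x)\<bar> \<le>
      (max 1 (exp (\<beta> * m)) - min 1 (exp (\<beta> * m))) * (2 * radius n)"
    unfolding w_def
  proof (rule abs_sum_diff_le_range_mult)
    show "(\<Sum>x<S. real (hits D h s a {x}) / real n) = sum (pmf (trans M h s a)) {..<S}"
      using sum_freq[OF n] sum_pmf_eq_1[OF _ set_trans[OF h s a]] by simp
    fix T assume T: "T \<subseteq> {..<S}"
    then have fin: "finite T" by (rule finite_subset) simp
    have "real (hits D h s a T) - real n * measure_pmf.prob (trans M h s a) T \<le> real n * (2 * radius n)"
      using conc n T by (auto simp: concentrated_def)
    then have "(real (hits D h s a T) - real n * measure_pmf.prob (trans M h s a) T) / real n \<le> 2 * radius n"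
      using n by (simp add: field_simps)
    then show "(\<Sum>x\<in>T. real (hits D h s a {x}) / real n) - sum (pmf (trans M h s a)) T \<le> 2 * radius n"
      using n fin hits_eq_sum[OF fin, of D h s a]
      by (simp add: measure_measure_pmf_finite diff_divide_distrib flip: sum_divide_distrib)
  qed (use u_range(3,4) in auto)
  moreover have "max 1 (exp (\<beta> * m)) - min 1 (exp (\<beta> * m)) = \<bar>exp (\<beta> * m) - 1\<bar>"
    by (auto simp: max_def min_def)
  ultimately show ?thesis by (simp add: b_def)
qed

text \<open>Optimism of one planning step: the bonus covers the estimation error. For negative
  \<beta> optimism means a smaller exponential, which is why the bonus is subtracted there.\<close>

lemma backup_le_qstep: "backup h s a v \<le> qstep D h v s a"
proof -
  have bm: "backup h s a v \<le> m"
    using backup_bounds(2)[OF h s a v] by simp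
  show ?thesis
  proof (cases "n = 0")
    case True
    then show ?thesis using bm by (simp add: Qalg_step_def)
  next
    case False
    then have n: "1 \<le> n" by simp
    show ?thesis
    proof (cases "0 < \<beta>")
      case True
      then have "exp (\<beta> * backup h s a v) \<le> exp (\<beta> * qstep D h v s a)"
        using exp_qstep[OF n] w_close[OF n] bm by auto
      then show ?thesis using True by simp
    next
      case neg: False
      then have "exp (\<beta> * qstep D h v s a) \<le> exp (\<beta> * backup h s a v)"
        using exp_qstep[OF n] w_close[OF n] bm by (auto intro: mult_left_mono_neg)
      then show ?thesis using neg beta by simp
    qed
  qed
qed

text \<open>The estimation error and the added bonus contribute \<open>b\<close> each, which gives
  the constant 4; truncation cannot increase the overestimate.\<close>

lemma psi_exp_qstep_le:
  assumes n: "1 \<le> n"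
  shows "psi \<beta> H * (exp (\<beta> * qstep D h v s a) - exp (\<beta> * backup h s a v)) \<le>
    4 * (\<bar>psi \<beta> H\<bar> * \<bar>exp (\<beta> * m) - 1\<bar>) * radius n"
proof -
  have "\<bar>exp (\<beta> * qstep D h v s a) - exp (\<beta> * backup h s a v)\<bar> \<le> 2 * b" if "0 < \<beta>"
  proof -
    have "exp (\<beta> * backup h s a v) \<le> exp (\<beta> * qstep D h v s a)"
      using that backup_le_qstep by simp
    then show ?thesis using exp_qstep[OF n] w_close[OF n] that by auto
  qed
  moreover have "\<bar>exp (\<beta> * qstep D h v s a) - exp (\<beta> * backup h s a v)\<bar> \<le> 2 * b" if "\<not> 0 < \<beta>"
  proof -
    have "exp (\<beta> * qstep D h v s a) \<le> exp (\<beta> * backup h s a v)"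
      using that backup_le_qstep by (simp add: mult_left_mono_neg)
    then show ?thesis using exp_qstep[OF n] w_close[OF n] that by auto
  qed
  ultimately have "\<bar>exp (\<beta> * qstep D h v s a) - exp (\<beta> * backup h s a v)\<bar> \<le> 2 * b" by blast
  then have "\<bar>psi \<beta> H\<bar> * \<bar>exp (\<beta> * qstep D h v s a) - exp (\<beta> * backup h s a v)\<bar> \<le> \<bar>psi \<beta> H\<bar> * (2 * b)"
    by (intro mult_left_mono) auto
  then show ?thesis
    using abs_ge_self[of "psi \<beta> H * (exp (\<beta> * qstep D h v s a) - exp (\<beta> * backup h s a v))"]
    by (simp add: abs_mult b_def mult_ac)
qed

end

end

end

section \<open>Optimism and the clipped regret decomposition\<close>

context rsvi2
begin

lemma pol:
  shows "pol D h s < A" "a' < A \<Longrightarrow> Qalg M \<beta> 2 K \<delta> D h s a' \<le> Qalg M \<beta> 2 K \<delta> D h s (pol D h s)"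
  using someI_ex[OF ex_argmax[of "\<lambda>a. Qalg M \<beta> 2 K \<delta> D h s a"]]
  unfolding alg_policy_def[symmetric] by blast+

lemma pol_policy: "pol D \<in> policies M"
  by (simp add: policies_def pol)

text \<open>The executed policy attains the maximum of the planning step, so the planned values
  follow the same actions as the episode itself.\<close>

lemma V_Suc:
  assumes "d < H"
  shows "V D (Suc d) s = qstep D (H - d) (V D d) s (pol D (H - d) s)"
  using assms pol(2)[of _ D "H - d" s] pol(1)[of D "H - d" s]
  by (auto simp: Qalg_def intro!: Max_eqI_argmax)

lemma V_bounds:
  assumes "valid_hist D" "d \<le> H" "s < S"
  shows "0 \<le> V D d s \<and> V D d s \<le> real d"
  using assms(2,3)
proof (induction d arbitrary: s)
  case (Suc d)
  then show ?case
    using V_Suc[of d D s] qstep_bounds[of D "H - d" s "pol D (H - d) s" "V D d"] assms(1) pol(1)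
    by (auto simp: of_nat_diff)
qed simp

lemma Vstar_le_V:
  assumes "good D" "d \<le> H" "s < S"
  shows "Vstar M \<beta> (Suc H - d) s \<le> V D d s"
  using assms(2,3)
proof (induction d arbitrary: s)
  case (Suc d)
  have h: "1 \<le> H - d" "H - d \<le> H" "Suc H - Suc d = H - d" "Suc (H - d) = Suc H - d" "H - (H - d) = d"
    using Suc.prems by auto
  have "Vstar M \<beta> (H - d) s \<in> Qstar M \<beta> (H - d) s ` {..<A}"
    using h Suc.prems A_pos by (subst Vstar_Max_Qstar) (auto simp: lessThan_empty_iff)
  then obtain a where a: "a < A" "Vstar M \<beta> (H - d) s = Qstar M \<beta> (H - d) s a" by auto
  have "Qstar M \<beta> (H - d) s a = backup (H - d) s a (Vstar M \<beta> (Suc H - d))"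
    using Qstar_backup[of "H - d" s a] h a Suc.prems by simp
  also have "\<dots> \<le> backup (H - d) s a (V D d)"
    using h a Suc by (intro backup_mono) auto
  also have "\<dots> \<le> qstep D (H - d) (V D d) s a"
    using h a Suc.prems assms(1) V_bounds[of D d] by (intro backup_le_qstep) (auto simp: good_def)
  also have "\<dots> \<le> V D (Suc d) s"
    using a by auto
  finally show ?case using h a by simp
qed (simp add: Vstar_terminal)

section \<open>Clipped bonuses and the regret of one episode\<close>

definition threshold :: real where
  "threshold = Delta_min M \<beta> / (2 * real H)"

lemma threshold_pos: "0 < threshold"
  using Delta_pos H_pos by (simp add: threshold_def)

text \<open>The count 0 is treated separately because division by zero makes \<open>radius 0\<close>
  equal to 0.\<close>

definition bonus :: "nat \<Rightarrow> real" where
  "bonus n = (if n = 0 then scale else min scale (4 * scale * radius n))"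

definition clipped :: "nat \<Rightarrow> real" where
  "clipped n = max 0 (bonus n - threshold)"

definition clipped_at :: "episode list \<Rightarrow> nat \<Rightarrow> nat \<Rightarrow> nat \<Rightarrow> real" where
  "clipped_at D h s a = clipped (cnt D h s a)"

text \<open>The history \<open>D\<close> stays fixed during the episode, for the policy and for the
  counts alike.\<close>

definition F :: "episode list \<Rightarrow> nat \<Rightarrow> nat \<Rightarrow> real" where
  "F D h s = E (run_from M (pol D) h (Suc H - h) s) (path_sum (clipped_at D) h)"

lemma clipped_nonneg: "0 \<le> clipped n"
  by (simp add: clipped_def)

lemma bonus_le_clipped: "bonus n \<le> clipped n + threshold"
  by (simp add: clipped_def)

lemma clipped_le_scale: "clipped n \<le> scale"
  using scale_ge_1 threshold_pos by (auto simp: clipped_def bonus_def)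

lemma F_nonneg:
  assumes "1 \<le> h" "h \<le> Suc H" "s < S"
  shows "0 \<le> F D h s"
  unfolding F_def using assms
  by (intro E_ge_const finite_run_from)
    (auto simp: pol_policy path_sum_def clipped_at_def clipped_nonneg intro!: sum_nonneg)

lemma F_rec:
  assumes "1 \<le> h" "h \<le> H" "s < S"
  shows "F D h s = clipped (cnt D h s (pol D h s)) + E (trans M h s (pol D h s)) (F D (Suc h))"
proof -
  have n: "Suc H - h = Suc (H - h)" "Suc H - Suc h = H - h" using assms by auto
  have "F D h s = clipped_at D h s (pol D h s) + E (trans M h s (pol D h s))
      (\<lambda>s'. E (run_from M (pol D) (Suc h) (H - h) s') (path_sum (clipped_at D) (Suc h)))"
    unfolding F_def n using assms by (intro E_path_sum_Suc) (auto simp: pol_policy)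
  then show ?thesis by (simp add: F_def[abs_def] clipped_at_def)
qed

text \<open>The weighted difference splits into the error of one planning step, which the bonus
  controls, and a difference of two backups, which is an average of the same quantity one step later
  with an extended prefix. Replacing the bonus by its clipped version adds one
  \<open>threshold\<close> per step.\<close>

lemma overestimate_step:
  assumes good: "good D" and h: "1 \<le> h" "h \<le> H" and s: "s < S" and \<tau>: "valid_prefix \<tau>"
    and IH: "\<And>s' \<tau>'. s' < S \<Longrightarrow> valid_prefix \<tau>' \<Longrightarrow>
      psi \<beta> H * exp (\<beta> * prefix_reward M \<tau>' (Suc h)) *
        (exp (\<beta> * V D (H - h) s') - exp (\<beta> * Vstar M \<beta> (Suc h) s'))
      \<le> F D (Suc h) s' + real (H - h) * threshold"
  defines "a \<equiv> pol D h s"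
  shows "psi \<beta> H * exp (\<beta> * prefix_reward M \<tau> h) *
      (exp (\<beta> * V D (Suc (H - h)) s) - exp (\<beta> * Qstar M \<beta> h s a))
    \<le> F D h s + real (Suc H - h) * threshold"
proof -
  let ?v = "V D (H - h)" and ?v' = "Vstar M \<beta> (Suc h)" and ?P = "trans M h s a" and ?n = "cnt D h s a"
  let ?R = "prefix_reward M \<tau> h" and ?\<tau> = "\<tau>[h - 1 := (s, a)]"
  have a: "a < A" by (simp add: a_def pol)
  have valid: "valid_hist D" and conc: "1 \<le> ?n \<longrightarrow> concentrated D h s a"
    using good h s a by (auto simp: good_def)
  have v: "0 \<le> ?v s' \<and> ?v s' \<le> real (H - h)" if "s' < S" for s'
    using that valid V_bounds by auto
  have q: "V D (Suc (H - h)) s = qstep D h ?v s a"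
    using V_Suc[of "H - h" D s] h by (simp add: a_def)
  note qb = qstep_bounds[OF valid h s a v]
  note Qb = Qstar_bounds[OF h s a]
  note R = prefix_reward_bounds[OF \<tau>, of h]
  note t = finite_trans[OF h s a] set_trans[OF h s a]
  let ?L = "psi \<beta> H * exp (\<beta> * ?R) * (exp (\<beta> * qstep D h ?v s a) - exp (\<beta> * Qstar M \<beta> h s a))"
  have tail_nonneg: "0 \<le> E ?P (F D (Suc h))"
    using t F_nonneg h by (intro E_ge_const) auto
  have threshold_nonneg: "0 \<le> real (H - h) * threshold"
    using threshold_pos by simp
  \<comment> \<open>The trivial bound on the whole difference; it yields the \<open>scale\<close>
    branch of the minimum in \<open>bonus\<close> and settles unvisited pairs.\<close>
  have cap: "?L \<le> scale"
    using h R qb Qb by (intro psi_exp_diff_le_scale) auto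
  have "?L \<le> bonus ?n + E ?P (F D (Suc h)) + real (H - h) * threshold"
  proof (cases "?n = 0")
    case True
    then show ?thesis using cap tail_nonneg threshold_nonneg by (simp add: bonus_def)
  next
    case False
    then have n: "1 \<le> ?n" by simp
    have "psi \<beta> H * (exp (\<beta> * qstep D h ?v s a) - exp (\<beta> * backup h s a ?v)) \<le>
        4 * (\<bar>psi \<beta> H\<bar> * \<bar>exp (\<beta> * real (H - h + 1)) - 1\<bar>) * radius ?n"
      by (rule psi_exp_qstep_le[OF valid h s a v conc n])
    then have "exp (\<beta> * ?R) * (psi \<beta> H * (exp (\<beta> * qstep D h ?v s a) - exp (\<beta> * backup h s a ?v))) \<le>
        exp (\<beta> * ?R) * (4 * (\<bar>psi \<beta> H\<bar> * \<bar>exp (\<beta> * real (H - h + 1)) - 1\<bar>) * radius ?n)"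
      by (intro mult_left_mono) auto
    also have "\<dots> = 4 * (\<bar>psi \<beta> H\<bar> * exp (\<beta> * ?R) * \<bar>exp (\<beta> * real (H - h + 1)) - 1\<bar>) * radius ?n"
      by (simp only: mult_ac)
    also have "\<dots> \<le> 4 * scale * radius ?n"
      using psi_weight_le_scale[OF h R(1) R(2)] h radius_nonneg
      by (intro mult_right_mono mult_left_mono) auto
    finally have first: "psi \<beta> H * exp (\<beta> * ?R) *
        (exp (\<beta> * qstep D h ?v s a) - exp (\<beta> * backup h s a ?v)) \<le> 4 * scale * radius ?n"
      by (simp only: mult_ac)
    have "psi \<beta> H * exp (\<beta> * ?R) * (exp (\<beta> * backup h s a ?v) - exp (\<beta> * backup h s a ?v')) =
        psi \<beta> H * exp (\<beta> * prefix_reward M ?\<tau> (Suc h)) * E ?P (\<lambda>s'. exp (\<beta> * ?v s') - exp (\<beta> * ?v' s'))"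
      unfolding exp_backup[OF h s a] prefix_reward_update[OF \<tau> h]
      using t by (simp add: E_diff ring_distribs exp_add)
    also have "\<dots> = E ?P (\<lambda>s'. psi \<beta> H * exp (\<beta> * prefix_reward M ?\<tau> (Suc h)) * (exp (\<beta> * ?v s') - exp (\<beta> * ?v' s')))"
      by simp
    also have "\<dots> \<le> E ?P (\<lambda>s'. F D (Suc h) s' + real (H - h) * threshold)"
      using t valid_prefix_update[OF \<tau> s a] by (intro E_mono IH) auto
    also have "\<dots> = E ?P (F D (Suc h)) + real (H - h) * threshold"
      using t by (subst E_add) auto
    finally have second: "psi \<beta> H * exp (\<beta> * ?R) * (exp (\<beta> * backup h s a ?v) - exp (\<beta> * backup h s a ?v')) \<le>
        E ?P (F D (Suc h)) + real (H - h) * threshold" .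
    have "?L = psi \<beta> H * exp (\<beta> * ?R) * (exp (\<beta> * qstep D h ?v s a) - exp (\<beta> * backup h s a ?v)) +
        psi \<beta> H * exp (\<beta> * ?R) * (exp (\<beta> * backup h s a ?v) - exp (\<beta> * backup h s a ?v'))"
      by (simp add: Qstar_backup[OF h s a] right_diff_distrib)
    then have "?L \<le> 4 * scale * radius ?n + E ?P (F D (Suc h)) + real (H - h) * threshold"
      using first second by linarith
    moreover have "?L \<le> scale + E ?P (F D (Suc h)) + real (H - h) * threshold"
      using cap tail_nonneg threshold_nonneg by linarith
    ultimately show ?thesis using False by (simp add: bonus_def min_def)
  qed
  also have "\<dots> \<le> clipped ?n + threshold + E ?P (F D (Suc h)) + real (H - h) * threshold"
    using bonus_le_clipped[of ?n] by simp
  also have "\<dots> = F D h s + real (Suc H - h) * threshold"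
    using F_rec[OF h s, of D] h by (simp add: a_def Suc_diff_le algebra_simps)
  finally show ?thesis unfolding q .
qed

text \<open>The induction closes because \<open>Qstar\<close> of the executed action is at most
  \<open>Vstar\<close>, so comparing with \<open>Vstar\<close> only decreases the
  overestimate.\<close>

lemma Vstar_overestimate:
  assumes "good D" "d \<le> H" "s < S" "valid_prefix \<tau>"
  shows "psi \<beta> H * exp (\<beta> * prefix_reward M \<tau> (Suc H - d)) *
      (exp (\<beta> * V D d s) - exp (\<beta> * Vstar M \<beta> (Suc H - d) s))
    \<le> F D (Suc H - d) s + real d * threshold"
  using assms(2-)
proof (induction d arbitrary: s \<tau>)
  case 0
  then show ?case by (simp add: Vstar_terminal F_nonneg)
next
  case (Suc d)
  let ?h = "H - d" and ?a = "pol D (H - d) s"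
  have h: "1 \<le> ?h" "?h \<le> H" "Suc H - Suc d = ?h" "Suc ?h = Suc H - d" "H - ?h = d" "Suc H - ?h = Suc d"
    using Suc.prems by auto
  have "psi \<beta> H * exp (\<beta> * prefix_reward M \<tau> ?h) * (exp (\<beta> * V D (Suc d) s) - exp (\<beta> * Vstar M \<beta> ?h s))
      \<le> psi \<beta> H * exp (\<beta> * prefix_reward M \<tau> ?h) * (exp (\<beta> * V D (Suc d) s) - exp (\<beta> * Qstar M \<beta> ?h s ?a))"
    using Qstar_le_Vstar[of ?h s ?a] h Suc.prems pol by (intro weighted_diff_mono) auto
  also have "\<dots> \<le> F D ?h s + real (Suc d) * threshold"
    using overestimate_step[of D ?h s \<tau>] assms(1) h Suc by (simp del: Valg.simps)
  finally show ?case using h by simp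
qed

text \<open>By optimism the gap is at most \<open>F\<close> plus at most \<open>H\<close>
  thresholds, that is, plus half of \<open>Delta_min\<close>. A nonzero gap is at least
  \<open>Delta_min\<close>, so this half is absorbed into the left side, which doubles
  \<open>F\<close>.\<close>

lemma gap_le_F:
  assumes "good D" "1 \<le> h" "h \<le> H" "s < S" "valid_prefix \<tau>"
  shows "gap M \<beta> h s (pol D h s) \<tau> \<le> 2 * F D h s"
proof (cases "gap M \<beta> h s (pol D h s) \<tau> = 0")
  case True
  then show ?thesis using F_nonneg[of h s D] assms by simp
next
  case False
  let ?a = "pol D h s" and ?R = "exp (\<beta> * prefix_reward M \<tau> h)"
  have d: "Suc H - h = Suc (H - h)" "Suc H - Suc (H - h) = h" "Suc H - (H - h) = Suc h" using assms by auto
  have "gap M \<beta> h s ?a \<tau> \<le> psi \<beta> H * ?R * (exp (\<beta> * V D (Suc (H - h)) s) - exp (\<beta> * Qstar M \<beta> h s ?a))"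
    unfolding gap_def using Vstar_le_V[of D "Suc (H - h)" s] assms d
    by (intro weighted_diff_mono) (auto simp del: Valg.simps)
  also have "\<dots> \<le> F D h s + real (Suc H - h) * threshold"
    using assms Vstar_overestimate[of D "H - h"] d by (intro overestimate_step) auto
  also have "real (Suc H - h) * threshold \<le> real H * threshold"
    using assms threshold_pos by (intro mult_right_mono) auto
  also have "\<dots> = Delta_min M \<beta> / 2"
    using H_pos by (simp add: threshold_def)
  also have "\<dots> \<le> gap M \<beta> h s ?a \<tau> / 2"
    using Delta_min_le_gap[OF assms(5,2,3,4) _ False] pol by simp
  finally show ?thesis by simp
qed

text \<open>The regret is the gap of the current action plus the expected regret of the next step
  under the extended prefix. Each of the \<open>d\<close> gaps costs at most twice the current
  \<open>F\<close>, because the expected later \<open>F\<close> never exceeds the current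
  one.\<close>

lemma weighted_regret_le_F:
  assumes "good D" "d \<le> H" "s < S" "valid_prefix \<tau>"
  shows "psi \<beta> H * exp (\<beta> * prefix_reward M \<tau> (Suc H - d)) *
      (exp (\<beta> * Vstar M \<beta> (Suc H - d) s) - exp (\<beta> * Vpi M \<beta> (pol D) (Suc H - d) s))
    \<le> 2 * real d * F D (Suc H - d) s"
  using assms(2-)
proof (induction d arbitrary: s \<tau>)
  case 0
  then show ?case by (simp add: Vstar_terminal Vpi_terminal)
next
  case (Suc d)
  let ?h = "H - d" and ?a = "pol D (H - d) s"
  let ?P = "trans M ?h s ?a" and ?\<tau> = "\<tau>[H - d - 1 := (s, pol D (H - d) s)]"
  let ?v = "Vstar M \<beta> (Suc ?h)" and ?v' = "Vpi M \<beta> (pol D) (Suc ?h)"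
  let ?R = "prefix_reward M \<tau> ?h"
  have h: "1 \<le> ?h" "?h \<le> H" "Suc H - Suc d = ?h" "Suc H - d = Suc ?h"
    using Suc.prems by auto
  note a = pol(1)[of D ?h s] and s = Suc.prems(2)
  note t = finite_trans[OF h(1,2) s a] set_trans[OF h(1,2) s a]
  have split: "psi \<beta> H * exp (\<beta> * ?R) * (exp (\<beta> * Vstar M \<beta> ?h s) - exp (\<beta> * Vpi M \<beta> (pol D) ?h s)) =
      gap M \<beta> ?h s ?a \<tau> + psi \<beta> H * exp (\<beta> * ?R) *
        (exp (\<beta> * backup ?h s ?a ?v) - exp (\<beta> * backup ?h s ?a ?v'))"
    using Vpi_backup[OF pol_policy h(1,2) s, of D] Qstar_backup[OF h(1,2) s a]
    by (simp add: gap_def right_diff_distrib)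
  have "psi \<beta> H * exp (\<beta> * ?R) * (exp (\<beta> * backup ?h s ?a ?v) - exp (\<beta> * backup ?h s ?a ?v')) =
        psi \<beta> H * exp (\<beta> * prefix_reward M ?\<tau> (Suc ?h)) * E ?P (\<lambda>s'. exp (\<beta> * ?v s') - exp (\<beta> * ?v' s'))"
    unfolding exp_backup[OF h(1,2) s a] prefix_reward_update[OF Suc.prems(3) h(1,2)]
    using t by (simp add: E_diff ring_distribs exp_add)
  also have "\<dots> = E ?P (\<lambda>s'. psi \<beta> H * exp (\<beta> * prefix_reward M ?\<tau> (Suc ?h)) * (exp (\<beta> * ?v s') - exp (\<beta> * ?v' s')))"
    by simp
  also have "\<dots> \<le> E ?P (\<lambda>s'. 2 * real d * F D (Suc ?h) s')"
    using t valid_prefix_update[OF Suc.prems(3) s a] Suc.IH Suc.prems h by (intro E_mono) auto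
  also have "\<dots> = 2 * real d * E ?P (F D (Suc ?h))"
    by simp
  also have "\<dots> \<le> 2 * real d * F D ?h s"
    using F_rec[OF h(1,2) s, of D] clipped_nonneg by (intro mult_left_mono) auto
  finally have tail: "psi \<beta> H * exp (\<beta> * ?R) * (exp (\<beta> * backup ?h s ?a ?v) - exp (\<beta> * backup ?h s ?a ?v'))
      \<le> 2 * real d * F D ?h s" .
  have "gap M \<beta> ?h s ?a \<tau> \<le> 2 * F D ?h s"
    using h Suc.prems assms(1) by (intro gap_le_F) auto
  then have "psi \<beta> H * exp (\<beta> * ?R) * (exp (\<beta> * Vstar M \<beta> ?h s) - exp (\<beta> * Vpi M \<beta> (pol D) ?h s)) \<le>
      2 * real (Suc d) * F D ?h s"
    using split tail by (simp add: distrib_right distrib_left)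
  then show ?case unfolding h .
qed

lemma episode_regret_le_F:
  assumes "good D"
  shows "Vstar M \<beta> 1 (init M) - Vpi M \<beta> (pol D) 1 (init M) \<le> 2 * real H * F D 1 (init M)"
proof -
  obtain \<tau> where "valid_prefix \<tau>" using ex_valid_prefix by blast
  then have "psi \<beta> H * (exp (\<beta> * Vstar M \<beta> 1 (init M)) - exp (\<beta> * Vpi M \<beta> (pol D) 1 (init M)))
      \<le> 2 * real H * F D 1 (init M)"
    using weighted_regret_le_F[of D H "init M" \<tau>] assms init_less by simp
  moreover have "Vstar M \<beta> 1 (init M) - Vpi M \<beta> (pol D) 1 (init M) \<le>
      psi \<beta> H * (exp (\<beta> * Vstar M \<beta> 1 (init M)) - exp (\<beta> * Vpi M \<beta> (pol D) 1 (init M)))"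
    using Vpi_nonneg[of "pol D" 1 "init M"] Vpi_le_Vstar[of "pol D" 1 "init M"]
      Vstar_bounds[of 1 "init M"] pol_policy init_less
    by (intro diff_le_psi_exp_diff) auto
  ultimately show ?thesis by linarith
qed

section \<open>Summing the clipped bonuses\<close>

lemma clipped_Suc_le: "clipped (Suc n) \<le> max 0 (4 * scale * sqrt (real S * iota) / sqrt (real (Suc n)) - threshold)"
  by (auto simp: clipped_def bonus_def radius_def real_sqrt_divide)

end

text \<open>Each term that is not clipped away is at most the increment of the bounded potential
  \<open>2 \<alpha> min (\<surd>n) (\<alpha> / \<theta>)\<close>.\<close>
lemma sum_clipped_inverse_sqrt_le:
  fixes \<alpha> \<theta> :: real
  assumes "0 \<le> \<alpha>" "0 < \<theta>"
  shows "(\<Sum>n<N. max 0 (\<alpha> / sqrt (real (Suc n)) - \<theta>)) \<le> 2 * \<alpha>\<^sup>2 / \<theta>"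
proof -
  define \<Phi> where "\<Phi> n = 2 * \<alpha> * min (sqrt (real n)) (\<alpha> / \<theta>)" for n
  have step: "max 0 (\<alpha> / sqrt (real (Suc n)) - \<theta>) \<le> \<Phi> (Suc n) - \<Phi> n" for n
  proof (cases "\<alpha> / sqrt (real (Suc n)) \<le> \<theta>")
    case True
    have "\<Phi> n \<le> \<Phi> (Suc n)"
      unfolding \<Phi>_def using assms by (intro mult_left_mono min.mono) auto
    then show ?thesis using True by simp
  next
    case False
    let ?x = "sqrt (real (Suc n))" and ?y = "sqrt (real n)"
    \<comment> \<open>An unclipped term has both roots below the cap, so the potential grows by
      \<open>2 * \<alpha> * (?x - ?y)\<close>, and \<open>?x - ?y\<close> is at least
      \<open>1 / (2 * ?x)\<close>.\<close>
    have x: "0 < ?x" "0 \<le> ?y" "?y \<le> ?x" by auto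
    have "?x \<le> \<alpha> / \<theta>" using False x assms by (simp add: field_simps)
    moreover from this x have "?y \<le> \<alpha> / \<theta>" by linarith
    ultimately have \<Phi>: "\<Phi> (Suc n) - \<Phi> n = 2 * \<alpha> * (?x - ?y)"
      using x by (simp add: \<Phi>_def min_def right_diff_distrib)
    have "1 = ?x\<^sup>2 - ?y\<^sup>2" by simp
    also have "\<dots> = (?x - ?y) * (?x + ?y)" by (simp only: power2_eq_square square_diff_square_factored mult.commute)
    also have "\<dots> \<le> (?x - ?y) * (2 * ?x)" using x by (intro mult_left_mono) linarith+
    finally have "1 / ?x \<le> 2 * (?x - ?y)" using x by (simp add: field_simps)
    then have "\<alpha> * (1 / ?x) \<le> \<alpha> * (2 * (?x - ?y))" using assms by (intro mult_left_mono)
    then have "\<alpha> / ?x \<le> \<Phi> (Suc n) - \<Phi> n" unfolding \<Phi> by (simp only: mult_ac) simp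
    then show ?thesis using False assms by simp
  qed
  have "(\<Sum>n<N. max 0 (\<alpha> / sqrt (real (Suc n)) - \<theta>)) \<le> (\<Sum>n<N. \<Phi> (Suc n) - \<Phi> n)"
    by (intro sum_mono step)
  also have "\<dots> = \<Phi> N - \<Phi> 0" by (rule sum_lessThan_telescope)
  also have "\<dots> \<le> 2 * \<alpha> * (\<alpha> / \<theta>)"
    using assms mult_left_mono[of "min (sqrt (real N)) (\<alpha> / \<theta>)" "\<alpha> / \<theta>" "2 * \<alpha>"]
    unfolding \<Phi>_def by simp
  finally show ?thesis by (simp add: power2_eq_square)
qed

text \<open>Successive visits of a pair see the counts 0, 1, 2 and so on, since the count is taken
  before the visit.\<close>

lemma sum_visits_eq:
  fixes f :: "nat \<Rightarrow> real"
  shows "(\<Sum>k<length D. if st (D ! k) h = s \<and> ac (D ! k) h = a then f (cnt (take k D) h s a) else 0) =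
    (\<Sum>n<cnt D h s a. f n)"
proof (induction D rule: rev_induct)
  case (snoc e D)
  have "(\<Sum>k<length D. if st ((D @ [e]) ! k) h = s \<and> ac ((D @ [e]) ! k) h = a
        then f (cnt (take k (D @ [e])) h s a) else 0) =
      (\<Sum>k<length D. if st (D ! k) h = s \<and> ac (D ! k) h = a then f (cnt (take k D) h s a) else 0)"
    by (intro sum.cong) (auto simp: nth_append)
  then show ?case using snoc by (auto simp: cnt_def)
qed (simp add: cnt_def)

context rsvi2
begin

text \<open>The first summand pays for the first visit, at count 0; the second is the potential
  bound for all later visits, whatever their number.\<close>

definition clipped_total :: real where
  "clipped_total = scale + 2 * (4 * scale * sqrt (real S * iota))\<^sup>2 / threshold"

lemma sum_clipped_le: "(\<Sum>n<N. clipped n) \<le> clipped_total"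
proof (cases N)
  case 0
  then show ?thesis using scale_ge_1 threshold_pos by (simp add: clipped_total_def)
next
  case (Suc m)
  have "(\<Sum>n<N. clipped n) = clipped 0 + (\<Sum>n<m. clipped (Suc n))"
    unfolding Suc by (rule sum.lessThan_Suc_shift)
  also have "(\<Sum>n<m. clipped (Suc n)) \<le>
      (\<Sum>n<m. max 0 (4 * scale * sqrt (real S * iota) / sqrt (real (Suc n)) - threshold))"
    by (intro sum_mono clipped_Suc_le)
  also have "\<dots> \<le> 2 * (4 * scale * sqrt (real S * iota))\<^sup>2 / threshold"
    using scale_ge_1 iota_pos threshold_pos by (intro sum_clipped_inverse_sqrt_le) auto
  finally show ?thesis using clipped_le_scale[of 0] by (simp add: clipped_total_def)
qed

lemma path_sum_clipped:
  assumes "valid_episode e"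
  shows "path_sum (clipped_at D) 1 e = (\<Sum>h\<in>{1..H}. clipped (cnt D h (st e h) (ac e h)))"
  using assms sum.atLeast1_atMost_eq[of "\<lambda>h. clipped (cnt D h (st e h) (ac e h))" H]
  by (simp add: path_sum_def valid_episode_def clipped_at_def st_def ac_def)

lemma sum_path_sum_clipped_le:
  assumes "valid_hist D"
  shows "(\<Sum>k<length D. path_sum (clipped_at (take k D)) 1 (D ! k)) \<le>
    real H * real S * real A * clipped_total"
proof -
  have valid: "valid_episode (D ! k)" if "k < length D" for k
    using assms that by (auto simp: valid_hist_def)
  have "(\<Sum>k<length D. path_sum (clipped_at (take k D)) 1 (D ! k)) =
      (\<Sum>k<length D. \<Sum>h\<in>{1..H}. clipped (cnt (take k D) h (st (D ! k) h) (ac (D ! k) h)))"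
    using valid by (intro sum.cong refl path_sum_clipped) auto
  also have "\<dots> = (\<Sum>h\<in>{1..H}. \<Sum>k<length D. clipped (cnt (take k D) h (st (D ! k) h) (ac (D ! k) h)))"
    by (rule sum.swap)
  \<comment> \<open>Indicators of the visited pair are inserted so that the sum over episodes can be
    moved inside and taken for each pair separately.\<close>
  also have "\<dots> = (\<Sum>h\<in>{1..H}. \<Sum>k<length D. \<Sum>s<S. \<Sum>a<A.
      if st (D ! k) h = s \<and> ac (D ! k) h = a then clipped (cnt (take k D) h s a) else 0)"
  proof (intro sum.cong refl)
    fix h k assume hk: "h \<in> {1..H}" "k \<in> {..<length D}"
    let ?s = "st (D ! k) h" and ?a = "ac (D ! k) h"
    have b: "?s < S" "?a < A" using hk valid st_less[of "D ! k" h] ac_less[of "D ! k" h] by auto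
    have "(\<Sum>s<S. \<Sum>a<A. if ?s = s \<and> ?a = a then clipped (cnt (take k D) h s a) else 0) =
        (\<Sum>s<S. if ?s = s then clipped (cnt (take k D) h s ?a) else 0)"
      using b by (intro sum.cong) (auto simp: sum.delta')
    also have "\<dots> = clipped (cnt (take k D) h ?s ?a)"
      using b by simp
    finally show "clipped (cnt (take k D) h ?s ?a) =
        (\<Sum>s<S. \<Sum>a<A. if ?s = s \<and> ?a = a then clipped (cnt (take k D) h s a) else 0)" by simp
  qed
  also have "\<dots> = (\<Sum>h\<in>{1..H}. \<Sum>s<S. \<Sum>a<A. \<Sum>k<length D.
      if st (D ! k) h = s \<and> ac (D ! k) h = a then clipped (cnt (take k D) h s a) else 0)"
    by (subst sum.swap, subst sum.swap[of _ "{..<A}"]) (rule refl)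
  also have "\<dots> = (\<Sum>h\<in>{1..H}. \<Sum>s<S. \<Sum>a<A. \<Sum>n<cnt D h s a. clipped n)"
    by (simp only: sum_visits_eq)
  also have "\<dots> \<le> (\<Sum>h\<in>{1..H}. \<Sum>s<S. \<Sum>a<A. clipped_total)"
    by (intro sum_mono sum_clipped_le)
  finally show ?thesis by simp
qed

end

section \<open>Concentration\<close>

text \<open>Hoeffding's lemma for a Bernoulli variable: the moment generating function is
  \<open>1 + ?q * (exp l - 1)\<close>.\<close>

lemma E_exp_indicator_le:
  assumes "finite (set_pmf p)" "0 \<le> l"
  shows "E p (\<lambda>x. exp (l * (indicator T x - measure_pmf.prob p T) - l\<^sup>2 / 8)) \<le> 1"
proof -
  let ?q = "measure_pmf.prob p T"
  have q: "0 \<le> ?q" by simp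
  have pos: "0 < 1 + ?q * (exp l - 1)" using q assms(2) by (simp add: add_pos_nonneg)
  have "E p (\<lambda>x. exp (l * (indicator T x - ?q) - l\<^sup>2 / 8)) =
      E p (\<lambda>x. exp (- l * ?q - l\<^sup>2 / 8) * (1 + indicator T x * (exp l - 1)))"
    by (intro E_cong) (auto simp: indicator_def algebra_simps simp flip: exp_add)
  also have "\<dots> = exp (- l * ?q - l\<^sup>2 / 8) * (1 + ?q * (exp l - 1))"
    using assms(1) by (simp add: E_add)
  also have "\<dots> = exp (- l * ?q - l\<^sup>2 / 8) * exp (ln (1 + ?q * (exp l - 1)))"
    using pos by simp
  also have "\<dots> = exp ((- l * ?q + ln (1 + ?q * (exp l - 1))) - l\<^sup>2 / 8)"
    unfolding mult_exp_exp by (rule arg_cong[where f = exp]) simp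
  also have "\<dots> \<le> 1"
    using Hoeffdings_lemma_aux[OF assms(2) q] by simp
  finally show ?thesis .
qed

lemma exp_neg_le_linear:
  assumes "0 \<le> x" "x \<le> (1 :: real)"
  shows "exp (- x) \<le> 1 - x / 2"
proof -
  have "exp (- x) \<le> 1 / (1 + x)"
    using assms exp_ge_add_one_self[of x] by (simp add: exp_minus divide_simps)
  also have "\<dots> \<le> 1 - x / 2"
  proof -
    have "x * x \<le> x * 1" using assms by (intro mult_left_mono) auto
    then show ?thesis using assms by (simp add: field_simps)
  qed
  finally show ?thesis .
qed

text \<open>On the unit interval \<open>exp (- x)\<close> lies below \<open>1 - x / 2\<close>, hence
  the exponential moment of \<open>- X x / B\<close> is at most
  \<open>exp (- (E p X / (2 * B)))\<close>. The loss of a factor two in the mean makes the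
  fluctuation cost only logarithmic.\<close>

lemma E_exp_mean_diff_le:
  assumes fin: "finite (set_pmf p)" and X: "\<And>x. x \<in> set_pmf p \<Longrightarrow> 0 \<le> X x \<and> X x \<le> B" and "0 < B"
  shows "E p (\<lambda>x. exp (E p X / (2 * B) - X x / B)) \<le> 1"
proof -
  have "E p (\<lambda>x. exp (E p X / (2 * B) - X x / B)) \<le> E p (\<lambda>x. exp (E p X / (2 * B)) * (1 - X x / B / 2))"
  proof (rule E_mono[OF fin])
    fix x assume "x \<in> set_pmf p"
    then have "exp (- (X x / B)) \<le> 1 - X x / B / 2"
      using X[of x] \<open>0 < B\<close> by (intro exp_neg_le_linear) auto
    then have "exp (E p X / (2 * B)) * exp (- (X x / B)) \<le> exp (E p X / (2 * B)) * (1 - X x / B / 2)"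
      by (rule mult_left_mono) simp
    then show "exp (E p X / (2 * B) - X x / B) \<le> exp (E p X / (2 * B)) * (1 - X x / B / 2)"
      by (simp flip: exp_add)
  qed
  also have "\<dots> = exp (E p X / (2 * B)) * (1 - E p X / (2 * B))"
    using fin by (simp add: E_diff field_simps)
  also have "\<dots> \<le> exp (E p X / (2 * B)) * exp (- (E p X / (2 * B)))"
    using exp_ge_add_one_self[of "- (E p X / (2 * B))"] by (intro mult_left_mono) auto
  finally show ?thesis by (simp flip: exp_add)
qed

context rsvi2
begin

section \<open>Supermartingales along the adaptive history\<close>

abbreviation hist where "hist k \<equiv> rsvi2_hist M \<beta> 2 K \<delta> k"
abbreviation run where "run D \<equiv> run_from M (pol D) 1 H (init M)"

lemma run:
  shows "finite (set_pmf (run D))" "e \<in> set_pmf (run D) \<Longrightarrow> valid_episode e"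
proof -
  show "finite (set_pmf (run D))"
    by (rule finite_run_from[OF pol_policy _ _ init_less]) simp_all
  show "valid_episode e" if "e \<in> set_pmf (run D)"
    using set_run_from[OF pol_policy _ _ init_less that] by (simp add: valid_episode_def)
qed

lemma hist_finite: "finite (set_pmf (hist k))"
  by (induction k) (auto simp: run[unfolded One_nat_def])

lemma hist_valid: "D \<in> set_pmf (hist k) \<Longrightarrow> length D = k \<and> valid_hist D"
proof (induction k arbitrary: D)
  case (Suc k)
  then obtain D' e where "D' \<in> set_pmf (hist k)" "e \<in> set_pmf (run D')" "D = D' @ [e]"
    by auto
  then show ?case using Suc.IH[of D'] run(2)[of e D'] by (auto simp: valid_hist_def)
qed (simp add: valid_hist_def)

lemma E_hist_Suc: "E (hist (Suc k)) \<phi> = E (hist k) (\<lambda>D. E (run D) (\<lambda>e. \<phi> (D @ [e])))"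
  unfolding rsvi2_hist.simps using hist_finite run(1) by (subst E_bind) (auto simp del: One_nat_def)

text \<open>Each factor may depend on the past episodes and has conditional mean at most one, so the
  partial products form a supermartingale started at 1.\<close>

lemma E_hist_prod_le_1:
  assumes nonneg: "\<And>D e. 0 \<le> Y D e" and Y: "\<And>D. valid_hist D \<Longrightarrow> E (run D) (Y D) \<le> 1"
  shows "E (hist k) (\<lambda>D. \<Prod>i<k. Y (take i D) (D ! i)) \<le> 1"
proof (induction k)
  case (Suc k)
  have "E (hist (Suc k)) (\<lambda>D. \<Prod>i<Suc k. Y (take i D) (D ! i)) =
      E (hist k) (\<lambda>D. (\<Prod>i<k. Y (take i D) (D ! i)) * E (run D) (Y D))"
    unfolding E_hist_Suc
  proof (rule E_cong)
    fix D assume "D \<in> set_pmf (hist k)"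
    then have l: "length D = k" using hist_valid by blast
    have "(\<Prod>i<k. Y (take i (D @ [e])) ((D @ [e]) ! i)) = (\<Prod>i<k. Y (take i D) (D ! i))" for e
      using l by (intro prod.cong) (auto simp: nth_append)
    then show "E (run D) (\<lambda>e. \<Prod>i<Suc k. Y (take i (D @ [e])) ((D @ [e]) ! i)) =
        (\<Prod>i<k. Y (take i D) (D ! i)) * E (run D) (Y D)"
      using l by (simp add: nth_append)
  qed
  also have "\<dots> \<le> E (hist k) (\<lambda>D. \<Prod>i<k. Y (take i D) (D ! i))"
  proof (rule E_mono[OF hist_finite])
    fix D assume "D \<in> set_pmf (hist k)"
    then have "E (run D) (Y D) \<le> 1" using Y hist_valid by blast
    then show "(\<Prod>i<k. Y (take i D) (D ! i)) * E (run D) (Y D) \<le> (\<Prod>i<k. Y (take i D) (D ! i))"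
      using nonneg by (intro mult_left_le prod_nonneg) auto
  qed
  finally show ?case using Suc by linarith
qed simp

lemma hist_markov:
  assumes nonneg: "\<And>D e. 0 \<le> Y D e" and Y: "\<And>D. valid_hist D \<Longrightarrow> E (run D) (Y D) \<le> 1"
    and sub: "\<And>D. D \<in> set_pmf (hist K) \<Longrightarrow> D \<in> Z \<Longrightarrow> exp x \<le> (\<Prod>i<K. Y (take i D) (D ! i))"
  shows "measure_pmf.prob (hist K) Z \<le> exp (- x)"
proof -
  let ?W = "{D. exp x \<le> (\<Prod>i<K. Y (take i D) (D ! i))}"
  have "measure_pmf.prob (hist K) Z \<le> measure_pmf.prob (hist K) ?W"
    using sub by (intro measure_pmf.finite_measure_mono_AE) (auto simp: AE_measure_pmf_iff)
  moreover have "measure_pmf.prob (hist K) ?W * exp x \<le> 1"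
    using prob_ge_times_le_E[of "hist K" "\<lambda>D. \<Prod>i<K. Y (take i D) (D ! i)" "exp x"]
      E_hist_prod_le_1[OF nonneg Y, where k = K] hist_finite nonneg prod_nonneg
    by (smt (verit, best))
  ultimately have "measure_pmf.prob (hist K) Z * exp x \<le> 1"
    by (meson exp_ge_zero mult_right_mono order_trans)
  then show ?thesis by (simp add: exp_minus field_simps)
qed

section \<open>Deviations of the empirical transition frequencies\<close>

definition dev_factor :: "nat \<Rightarrow> nat \<Rightarrow> nat \<Rightarrow> nat set \<Rightarrow> real \<Rightarrow> episode \<Rightarrow> real" where
  "dev_factor h s a T l e = (if st e h = s \<and> ac e h = a
     then exp (l * (indicator T (st e (Suc h)) - measure_pmf.prob (trans M h s a) T) - l\<^sup>2 / 8) else 1)"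

text \<open>An episode that misses the pair contributes the factor 1; otherwise the successor is a
  fresh draw from the kernel and Hoeffding's lemma applies.\<close>

lemma E_dev_factor_le_1:
  assumes h: "1 \<le> h" "h \<le> H" and "0 \<le> l"
  shows "E (run D) (dev_factor h s a T l) \<le> 1"
proof -
  let ?\<phi> = "\<lambda>s0 a0 s'. if s0 = s \<and> a0 = a
     then exp (l * (indicator T s' - measure_pmf.prob (trans M h s a) T) - l\<^sup>2 / 8) else 1"
  have "E (run D) (\<lambda>e. ?\<phi> (fst e ! (h - 1)) (snd e ! (h - 1)) (fst e ! Suc (h - 1))) \<le> 1"
  proof (rule E_run_from_step_le_1)
    fix s0 assume s0: "s0 < S"
    have h': "1 + (h - 1) = h" using h by simp
    have "E (trans M h s0 (pol D h s0)) (\<lambda>s'. ?\<phi> s0 (pol D h s0) s') \<le> 1"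
      using E_exp_indicator_le[OF finite_trans[OF h s0 pol(1)[of D h s0]] assms(3), of T]
      by (cases "s0 = s"; cases "pol D h s0 = a"; simp)
    then show "E (trans M (1 + (h - 1)) s0 (pol D (1 + (h - 1)) s0)) (?\<phi> s0 (pol D (1 + (h - 1)) s0)) \<le> 1"
      unfolding h' .
  qed (use h init_less in \<open>auto simp: pol_policy\<close>)
  moreover have "dev_factor h s a T l = (\<lambda>e. ?\<phi> (fst e ! (h - 1)) (snd e ! (h - 1)) (fst e ! Suc (h - 1)))"
    using h by (auto simp: dev_factor_def st_def ac_def fun_eq_iff)
  ultimately show ?thesis by simp
qed

lemma prod_dev_factor:
  "(\<Prod>i<length D. dev_factor h s a T l (D ! i)) =
    exp (l * (real (hits D h s a T) - real (cnt D h s a) * measure_pmf.prob (trans M h s a) T)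
      - real (cnt D h s a) * l\<^sup>2 / 8)"
proof (induction D rule: rev_induct)
  case (snoc e D)
  have "(\<Prod>i<length D. dev_factor h s a T l ((D @ [e]) ! i)) = (\<Prod>i<length D. dev_factor h s a T l (D ! i))"
    by (intro prod.cong) (auto simp: nth_append)
  then show ?case using snoc
    by (auto simp: dev_factor_def hits_def cnt_def indicator_def algebra_simps add_divide_distrib simp flip: exp_add)
qed (simp add: hits_def cnt_def)

text \<open>The random count is pinned to a number \<open>n\<close>, so that the exponential
  parameter can be tuned to it; a union bound over \<open>n\<close> follows.\<close>

definition deviates :: "nat \<Rightarrow> nat \<Rightarrow> nat \<Rightarrow> nat \<Rightarrow> nat set \<Rightarrow> nat \<Rightarrow> episode list set" where
  "deviates j h s a T n = {D. cnt (take j D) h s a = n \<and>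
     real n * (2 * radius n) \<le> real (hits (take j D) h s a T) - real n * measure_pmf.prob (trans M h s a) T}"

lemma prob_deviates_le:
  assumes j: "j < K" and h: "1 \<le> h" "h \<le> H" and n: "1 \<le> n"
  shows "measure_pmf.prob (hist K) (deviates j h s a T n) \<le> exp (- (8 * (real S * iota)))"
proof -
  \<comment> \<open>This value maximises \<open>l * (2 * n * radius n) - n * l * l / 8\<close>; the
    maximum is 8 times \<open>real S * iota\<close>.\<close>
  let ?l = "8 * radius n"
  \<comment> \<open>Factors from episode \<open>j\<close> on are frozen at 1, so the product over
    all \<open>K\<close> episodes sees only the first \<open>j\<close>.\<close>
  let ?Y = "\<lambda>D e. if length D < j then dev_factor h s a T ?l e else 1"
  show ?thesis
  proof (rule hist_markov[where Y = ?Y])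
    show "0 \<le> ?Y D e" for D e by (simp add: dev_factor_def)
    show "E (run D) (?Y D) \<le> 1" for D
      using E_dev_factor_le_1[OF h, of ?l D s a T] radius_nonneg[of n] by (cases "length D < j") auto
    fix D assume D: "D \<in> set_pmf (hist K)" "D \<in> deviates j h s a T n"
    then have l: "length D = K" and c: "cnt (take j D) h s a = n" using hist_valid by (auto simp: deviates_def)
    have "(\<Prod>i<K. ?Y (take i D) (D ! i)) = (\<Prod>i<j. dev_factor h s a T ?l (D ! i))"
      using l j by (intro prod.mono_neutral_cong_right) auto
    also have "\<dots> = (\<Prod>i<length (take j D). dev_factor h s a T ?l (take j D ! i))"
      using l j by (intro prod.cong) auto
    finally have prod_eq: "(\<Prod>i<K. ?Y (take i D) (D ! i)) =
        exp (?l * (real (hits (take j D) h s a T) - real n * measure_pmf.prob (trans M h s a) T) - real n * ?l\<^sup>2 / 8)"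
      unfolding prod_dev_factor c .
    have r: "real n * (radius n)\<^sup>2 = real S * iota"
      using n iota_pos by (simp add: radius_def)
    have "8 * (real S * iota) = ?l * (real n * (2 * radius n)) - real n * ?l\<^sup>2 / 8"
      unfolding r[symmetric] by (simp add: power2_eq_square)
    also have "\<dots> \<le> ?l * (real (hits (take j D) h s a T) - real n * measure_pmf.prob (trans M h s a) T) - real n * ?l\<^sup>2 / 8"
      using D(2) radius_nonneg[of n] by (intro diff_mono mult_left_mono) (auto simp: deviates_def)
    finally show "exp (8 * (real S * iota)) \<le> (\<Prod>i<K. ?Y (take i D) (D ! i))"
      unfolding prod_eq by simp
  qed
qed

definition dev_index :: "(nat \<times> nat \<times> nat \<times> nat \<times> nat set \<times> nat) set" where
  "dev_index = {..<K} \<times> {1..H} \<times> {..<S} \<times> {..<A} \<times> Pow {..<S} \<times> {1..K}"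

definition not_concentrated :: "episode list set" where
  "not_concentrated = (\<Union>(j, h, s, a, T, n)\<in>dev_index. deviates j h s a T n)"

text \<open>The exponent is spent in three parts: one \<open>exp (- iota)\<close> cancels
  \<open>S * A * H * K\<close> and leaves \<open>\<delta> / 2\<close>, a second one cancels the
  other factor \<open>K\<close>, and \<open>exp (- (real S * iota))\<close> cancels the number of
  successor sets because \<open>iota\<close> is at least \<open>ln 2\<close>.\<close>

lemma prob_not_concentrated_le: "measure_pmf.prob (hist K) not_concentrated \<le> \<delta> / 2"
proof -
  have fin: "finite dev_index" by (simp add: dev_index_def)
  have "measure_pmf.prob (hist K) not_concentrated \<le>
      (\<Sum>i\<in>dev_index. measure_pmf.prob (hist K) (case i of (j, h, s, a, T, n) \<Rightarrow> deviates j h s a T n))"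
    unfolding not_concentrated_def by (intro measure_pmf.finite_measure_subadditive_finite fin) auto
  also have "\<dots> \<le> (\<Sum>i\<in>dev_index. exp (- (8 * (real S * iota))))"
    by (intro sum_mono) (auto simp: dev_index_def intro!: prob_deviates_le)
  also have "\<dots> = real K * (real H * (real S * (real A * (2 ^ S * real K)))) * exp (- (8 * (real S * iota)))"
    by (simp add: dev_index_def card_cartesian_product card_Pow)
  also have "\<dots> \<le> real K * (real H * (real S * (real A * (2 ^ S * real K)))) * (exp (- iota) * exp (- iota) * exp (- (real S * iota)))"
  proof (intro mult_left_mono)
    have "1 * iota \<le> real S * iota" using S_pos iota_pos by (intro mult_right_mono) auto
    then show "exp (- (8 * (real S * iota))) \<le> exp (- iota) * exp (- iota) * exp (- (real S * iota))"
      using iota_pos by (simp flip: exp_add)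
  qed auto
  also have "\<dots> \<le> real K * (real H * (real S * (real A * (2 ^ S * real K)))) * (exp (- iota) * exp (- iota) * (1 / 2 ^ S))"
  proof (intro mult_left_mono)
    have "exp (- (real S * iota)) \<le> exp (real S * - ln 2)"
      using iota_ge by (simp add: mult_left_mono)
    also have "\<dots> = exp (- ln 2) ^ S" by (rule exp_of_nat_mult)
    finally show "exp (- (real S * iota)) \<le> 1 / 2 ^ S"
      by (simp add: exp_minus power_divide inverse_eq_divide)
  qed auto
  also have "\<dots> = (real S * real A * real H * real K * exp (- iota)) * (real K * exp (- iota))"
    by (simp add: field_simps)
  also have "exp (- iota) = \<delta> / (2 * real S * real A * real H * real K)"
    using delta_pos SAHK_ge S_pos A_pos H_pos K_pos unfolding iota_def by (subst exp_minus) simp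
  also have "(real S * real A * real H * real K * (\<delta> / (2 * real S * real A * real H * real K))) *
      (real K * (\<delta> / (2 * real S * real A * real H * real K))) = \<delta> / 2 * (\<delta> / (2 * (real S * real A * real H)))"
    using S_pos A_pos H_pos K_pos by (simp add: field_simps)
  also have "\<dots> \<le> \<delta> / 2 * 1"
  proof (intro mult_left_mono)
    have "1 \<le> real S * real A * real H"
      using S_pos A_pos H_pos by (simp add: Suc_le_eq flip: of_nat_mult)
    then show "\<delta> / (2 * (real S * real A * real H)) \<le> 1"
      using delta_le by (simp add: divide_le_eq)
  qed (use delta_pos in auto)
  finally show ?thesis by simp
qed

lemma good_take:
  assumes D: "D \<in> set_pmf (hist K)" "D \<notin> not_concentrated" and j: "j < K"
  shows "good (take j D)"
  unfolding good_def
proof (intro conjI ballI allI impI)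
  have D': "length D = K" "valid_hist D" using D hist_valid by auto
  then show "valid_hist (take j D)" by (auto simp: valid_hist_def dest: in_set_takeD)
  fix h s a assume i: "h \<in> {1..H}" "s < S" "a < A" "1 \<le> cnt (take j D) h s a"
  let ?n = "cnt (take j D) h s a"
  have "?n \<le> length (take j D)" unfolding cnt_def by (rule length_filter_le)
  then have "?n \<le> K" using j by simp
  then have "D \<notin> deviates j h s a T ?n" if "T \<subseteq> {..<S}" for T
    using D(2) that i j unfolding not_concentrated_def dev_index_def by auto
  then show "concentrated (take j D) h s a"
    by (auto simp: concentrated_def deviates_def not_le less_imp_le)
qed

section \<open>Conditional expectations against realised sums of bonuses\<close>

definition clip_sum :: "episode list \<Rightarrow> episode \<Rightarrow> real" where
  "clip_sum D e = path_sum (clipped_at D) 1 e"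

definition excess :: "episode list set" where
  "excess = {D. ln (2 / \<delta>) \<le> (\<Sum>k<K. F (take k D) 1 (init M) / (2 * (real H * scale))
     - clip_sum (take k D) (D ! k) / (real H * scale))}"

lemma clip_sum_bounds:
  assumes "valid_episode e"
  shows "0 \<le> clip_sum D e" "clip_sum D e \<le> real H * scale"
proof -
  have "(\<Sum>h\<in>{1..H}. clipped (cnt D h (st e h) (ac e h))) \<le> (\<Sum>h\<in>{1..H}. scale)"
    by (intro sum_mono clipped_le_scale)
  then show "0 \<le> clip_sum D e" "clip_sum D e \<le> real H * scale"
    using path_sum_clipped[OF assms] by (auto simp: clip_sum_def clipped_nonneg intro!: sum_nonneg)
qed

lemma prob_excess_le: "measure_pmf.prob (hist K) excess \<le> \<delta> / 2"
proof -
  let ?B = "real H * scale"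
  have B: "0 < ?B" using H_pos scale_ge_1 by simp
  \<comment> \<open>At step 1, \<open>F\<close> is the conditional mean of the realised sum, as the
    mean-versus-value estimate requires.\<close>
  have F: "F D 1 (init M) = E (run D) (clip_sum D)" for D
    by (simp add: F_def clip_sum_def[abs_def])
  have "measure_pmf.prob (hist K) excess \<le> exp (- ln (2 / \<delta>))"
  proof (rule hist_markov[where Y = "\<lambda>D e. exp (F D 1 (init M) / (2 * ?B) - clip_sum D e / ?B)"])
    show "E (run D) (\<lambda>e. exp (F D 1 (init M) / (2 * ?B) - clip_sum D e / ?B)) \<le> 1" for D
      unfolding F using run clip_sum_bounds B by (intro E_exp_mean_diff_le) auto
    fix D assume "D \<in> excess"
    then show "exp (ln (2 / \<delta>)) \<le> (\<Prod>i<K. exp (F (take i D) 1 (init M) / (2 * ?B) - clip_sum (take i D) (D ! i) / ?B))"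
      by (simp add: excess_def del: exp_ln_iff flip: exp_sum)
  qed simp
  then show ?thesis using delta_pos by (simp add: exp_minus)
qed

section \<open>The regret bound with explicit terms\<close>

definition regret_bound :: real where
  "regret_bound = 4 * real H * (real H * real S * real A * clipped_total + real H * scale * ln (2 / \<delta>))"

text \<open>Outside both bad events, the factor \<open>2 * real H\<close> per episode and the factor
  two between conditional means and realised sums combine to the \<open>4 * real H\<close> of
  \<open>regret_bound\<close>.\<close>

lemma regret_le_bound:
  assumes D: "D \<in> set_pmf (hist K)" "D \<notin> not_concentrated" "D \<notin> excess"
  shows "regret M \<beta> 2 K \<delta> D \<le> regret_bound"
proof -
  let ?B = "real H * scale" and ?F = "\<lambda>k. F (take k D) 1 (init M)" and ?X = "\<lambda>k. clip_sum (take k D) (D ! k)"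
  have B: "0 < ?B" using H_pos scale_ge_1 by simp
  have D': "length D = K" "valid_hist D" using D hist_valid by auto
  have "(\<Sum>k<K. ?F k) / (2 * ?B) - (\<Sum>k<K. ?X k) / ?B < ln (2 / \<delta>)"
    using D(3) by (simp add: excess_def sum_subtractf not_le flip: sum_divide_distrib)
  moreover have "f \<le> 2 * x + 2 * b * c" if "f / (2 * b) - x / b < c" "0 < b" for f x b c :: real
    using that by (simp add: field_simps)
  ultimately have "(\<Sum>k<K. ?F k) \<le> 2 * (\<Sum>k<K. ?X k) + 2 * ?B * ln (2 / \<delta>)"
    using B by blast
  also have "\<dots> \<le> 2 * (real H * real S * real A * clipped_total) + 2 * ?B * ln (2 / \<delta>)"
    using sum_path_sum_clipped_le[OF D'(2)] D'(1) by (simp add: clip_sum_def)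
  finally have sum_F: "(\<Sum>k<K. ?F k) \<le> 2 * (real H * real S * real A * clipped_total) + 2 * ?B * ln (2 / \<delta>)" .
  have "regret M \<beta> 2 K \<delta> D \<le> (\<Sum>k<K. 2 * real H * ?F k)"
    unfolding regret_def using good_take[OF D(1,2)] by (intro sum_mono episode_regret_le_F) auto
  also have "\<dots> = 2 * real H * (\<Sum>k<K. ?F k)"
    by (simp add: sum_distrib_left)
  also have "\<dots> \<le> 2 * real H * (2 * (real H * real S * real A * clipped_total) + 2 * ?B * ln (2 / \<delta>))"
    using sum_F by (intro mult_left_mono) auto
  also have "\<dots> = regret_bound"
    by (simp add: regret_bound_def algebra_simps)
  finally show ?thesis .
qed

lemma prob_bad_le: "measure_pmf.prob (hist K) (not_concentrated \<union> excess) \<le> \<delta>"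
  using measure_Un_le[of not_concentrated "measure_pmf (hist K)" excess]
    prob_not_concentrated_le prob_excess_le by simp

lemma prob_regret_ge:
  assumes "regret_bound \<le> x"
  shows "1 - \<delta> \<le> measure_pmf.prob (hist K) {D. regret M \<beta> 2 K \<delta> D \<le> x}"
proof -
  have "1 - \<delta> \<le> measure_pmf.prob (hist K) (- (not_concentrated \<union> excess))"
    using prob_bad_le measure_pmf.prob_compl[of "not_concentrated \<union> excess" "hist K"]
    by (simp add: Compl_eq_Diff_UNIV)
  also have "\<dots> \<le> measure_pmf.prob (hist K) {D. regret M \<beta> 2 K \<delta> D \<le> x}"
    using regret_le_bound assms
    by (intro measure_pmf.finite_measure_mono_AE) (force simp: AE_measure_pmf_iff)+
  finally show ?thesis .
qed

lemma regret_le_trivial: "regret M \<beta> 2 K \<delta> D \<le> real H * real K"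
proof -
  have "regret M \<beta> 2 K \<delta> D \<le> (\<Sum>k<K. real H)"
    unfolding regret_def
  proof (rule sum_mono)
    fix k
    show "Vstar M \<beta> 1 (init M) - Vpi M \<beta> (pol (take k D)) 1 (init M) \<le> real H"
      using Vstar_bounds(2)[of 1 "init M"] Vpi_nonneg[of "pol (take k D)" 1 "init M"] pol_policy init_less
      by fastforce
  qed
  then show ?thesis by (simp add: mult.commute)
qed

lemma regret_bound_nonneg: "0 \<le> regret_bound"
  using scale_ge_1 threshold_pos delta_pos delta_le
  by (auto simp: regret_bound_def clipped_total_def intro!: mult_nonneg_nonneg add_nonneg_nonneg)

lemma E_regret_le: "E (hist K) (regret M \<beta> 2 K \<delta>) \<le> regret_bound + real H * real K * \<delta>"
proof -
  have "E (hist K) (regret M \<beta> 2 K \<delta>) \<le>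
      E (hist K) (\<lambda>D. regret_bound + real H * real K * indicator (not_concentrated \<union> excess) D)"
  proof (rule E_mono[OF hist_finite])
    fix D assume "D \<in> set_pmf (hist K)"
    then show "regret M \<beta> 2 K \<delta> D \<le> regret_bound + real H * real K * indicator (not_concentrated \<union> excess) D"
      using regret_le_bound[of D] regret_le_trivial[of D] regret_bound_nonneg by (auto simp: indicator_def)
  qed
  also have "\<dots> = regret_bound + real H * real K * measure_pmf.prob (hist K) (not_concentrated \<union> excess)"
    by (subst E_add) (auto simp: hist_finite)
  also have "\<dots> \<le> regret_bound + real H * real K * \<delta>"
    using prob_bad_le by (intro add_left_mono mult_left_mono) auto
  finally show ?thesis .
qed

section \<open>Absorbing lower-order terms and constants\<close>

text \<open>With a single action every gap vanishes. Two actions keep the argument of the final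
  logarithm at least 2, so constants can be absorbed into it.\<close>

lemma two_le_A: "2 \<le> A"
proof (rule ccontr)
  assume "\<not> 2 \<le> A"
  then have A: "A = 1" using A_pos by linarith
  obtain h s a \<tau> where g: "1 \<le> h" "h \<le> H" "s < S" "a < A" "gap M \<beta> h s a \<tau> \<noteq> 0"
    using gaps by (auto simp: gap_set_def)
  have "{..<A} = {a}" using A g by auto
  then have "Vstar M \<beta> h s = Qstar M \<beta> h s a" using g by (simp add: Vstar_Max_Qstar)
  then show False using g by (simp add: gap_def)
qed

text \<open>The ratio of \<open>scale\<close> to \<open>Delta_min\<close> is therefore at least one,
  which lets \<open>regret_scale\<close> dominate the terms that are only linear in
  \<open>scale\<close>.\<close>

lemma Delta_min_le_scale: "Delta_min M \<beta> \<le> scale"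
proof -
  have "Delta_min M \<beta> \<in> gap_set M \<beta>"
    unfolding Delta_min_def by (rule Min_in[OF finite_gap_set gaps])
  then show ?thesis
    using gap_le_scale by (fastforce simp: gap_set_def valid_prefix_def)
qed

lemma regret_scale_eq:
  "regret_scale M \<beta> = scale * (scale / Delta_min M \<beta>) * real H ^ 3 * real S ^ 2 * real A"
  by (simp add: regret_scale_def scale_def power2_eq_square power_divide)

lemma scale_ratio_ge_1: "1 \<le> scale / Delta_min M \<beta>"
  using Delta_min_le_scale Delta_pos by simp

lemma regret_scale_ge:
  "scale * real H ^ 2 * real S * real A \<le> regret_scale M \<beta>"
  "scale * real H ^ 2 \<le> regret_scale M \<beta>"
  "1 \<le> regret_scale M \<beta>"
proof -
  have s: "1 \<le> real S" "1 \<le> real A" "1 \<le> real H" using S_pos A_pos H_pos by auto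
  have "scale * 1 * real H ^ 2 * real S ^ 1 * real A \<le>
      scale * (scale / Delta_min M \<beta>) * real H ^ 3 * real S ^ 2 * real A"
    using s scale_ge_1 scale_ratio_ge_1 Delta_pos
    by (intro mult_mono power_increasing) (auto intro!: mult_nonneg_nonneg)
  then show 1: "scale * real H ^ 2 * real S * real A \<le> regret_scale M \<beta>"
    by (simp add: regret_scale_eq)
  have "scale * real H ^ 2 * 1 * 1 \<le> scale * real H ^ 2 * real S * real A"
    using s scale_ge_1 by (intro mult_mono) auto
  then show 2: "scale * real H ^ 2 \<le> regret_scale M \<beta>" using 1 by simp
  have "1 * 1 \<le> scale * real H ^ 2"
    using s scale_ge_1 by (intro mult_mono) auto
  then show "1 \<le> regret_scale M \<beta>" using 2 by simp
qed

lemma regret_bound_le: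
  "regret_bound \<le> 1048 * regret_scale M \<beta> * (ln (real H * real S * real A * real K / \<delta>))\<^sup>2"
proof -
  let ?L = "ln (real H * real S * real A * real K / \<delta>)" and ?r = "regret_scale M \<beta>"
  have s: "1 \<le> real S" "1 \<le> real A" "1 \<le> real H" "1 \<le> real K" using S_pos A_pos H_pos K_pos by auto
  have "2 \<le> real A * (real H * real S * real K)"
    using two_le_A s mult_mono[of 2 "real A" 1 "real H * real S * real K"]
      mult_mono[of 1 "real H * real S" 1 "real K"] mult_mono[of 1 "real H" 1 "real S"] by auto
  then have two: "2 / \<delta> \<le> real H * real S * real A * real K / \<delta>"
    using delta_pos by (intro divide_right_mono) (auto simp: mult_ac)
  then have ln2d: "ln (2 / \<delta>) \<le> ?L" using delta_pos by (intro ln_mono) auto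
  have "ln 2 \<le> ln (2 / \<delta>)" using delta_pos delta_le by (simp add: field_simps)
  then have ln2: "ln 2 \<le> ?L" using ln2d by linarith
  then have L: "1 / 2 \<le> ?L" using ln2_ge_two_thirds by linarith
  have "iota = ln (2 * (real H * real S * real A * real K / \<delta>))"
    by (simp add: iota_def mult_ac)
  also have "\<dots> = ln 2 + ?L"
    using s delta_pos by (intro ln_mult_pos) auto
  finally have iota: "iota \<le> 2 * ?L" using ln2 by linarith
  have LL: "?L \<le> 2 * ?L\<^sup>2"
    using L mult_right_mono[of "1 / 2" ?L ?L] by (simp add: power2_eq_square)
  \<comment> \<open>The 256 is the product of 4, of 2 times the square of 4 in
    \<open>clipped_total\<close>, and of the 2 in the denominator of
    \<open>threshold\<close>.\<close>
  have "regret_bound = 4 * (scale * real H ^ 2 * real S * real A) + 256 * ?r * iota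
      + 4 * (scale * real H ^ 2) * ln (2 / \<delta>)"
    using iota_pos Delta_pos H_pos
    by (simp add: regret_bound_def clipped_total_def threshold_def regret_scale_eq power_mult_distrib
        field_simps power2_eq_square power3_eq_cube)
  also have "\<dots> \<le> 4 * ?r + 256 * ?r * (2 * ?L) + 4 * ?r * ?L"
    using regret_scale_ge iota ln2d iota_pos delta_pos delta_le scale_ge_1
    by (intro add_mono mult_mono) auto
  also have "\<dots> = ?r * (4 + 516 * ?L)" by (simp add: algebra_simps)
  \<comment> \<open>Since \<open>?L\<close> is at least one half, 4 is at most 16 times its square
    and \<open>516 * ?L\<close> at most 1032 times its square.\<close>
  also have "\<dots> \<le> ?r * (1048 * ?L\<^sup>2)"
    using regret_scale_ge(3) L LL by (intro mult_left_mono) auto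
  finally show ?thesis by (simp add: mult_ac)
qed

end

theorem theorem1:
  "\<exists>c>0. \<exists>C>0. \<forall>(M::mdp) (\<beta>::real) (K::nat).
     wf_mdp M \<longrightarrow> K \<ge> 1 \<longrightarrow> \<beta> \<noteq> 0 \<longrightarrow> gap_set M \<beta> \<noteq> {} \<longrightarrow> Delta_min M \<beta> > 0 \<longrightarrow>
     (\<forall>\<delta>::real. 0 < \<delta> \<and> \<delta> \<le> 1 \<longrightarrow>
        measure_pmf.prob (rsvi2_hist M \<beta> c K \<delta> K)
          {D. regret M \<beta> c K \<delta> D \<le> C * regret_scale M \<beta> *
                 (ln (real (horizon M) * real (nS M) * real (nA M) * real K / \<delta>))^2}
        \<ge> 1 - \<delta>)
     \<and> measure_pmf.expectation (rsvi2_hist M \<beta> c K (1 / (real (horizon M) * real K)) K)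
          (regret M \<beta> c K (1 / (real (horizon M) * real K)))
        \<le> C * regret_scale M \<beta> *
           (ln (real (horizon M) * real (nS M) * real (nA M) * real K))^2"
proof (intro exI conjI allI impI)
  fix M :: mdp and \<beta> :: real and K :: nat
  assume *: "wf_mdp M" "K \<ge> 1" "\<beta> \<noteq> 0" "gap_set M \<beta> \<noteq> {}" "Delta_min M \<beta> > 0"
  \<comment> \<open>The witnesses 2 and 4196 are fixed here; the larger constant is dictated by the
    bound in expectation.\<close>
  show "1 - \<delta> \<le> measure_pmf.prob (rsvi2_hist M \<beta> 2 K \<delta> K)
      {D. regret M \<beta> 2 K \<delta> D \<le> 4196 * regret_scale M \<beta> *
        (ln (real (horizon M) * real (nS M) * real (nA M) * real K / \<delta>))^2}"
    if "0 < \<delta> \<and> \<delta> \<le> 1" for \<delta>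
  proof -
    interpret rsvi2 M \<beta> K \<delta> using * that by unfold_locales auto
    show ?thesis
      using regret_scale_ge(3) by (intro prob_regret_ge order_trans[OF regret_bound_le] mult_right_mono) auto
  qed
  let ?\<delta> = "1 / (real (horizon M) * real K)"
  have H: "1 \<le> horizon M" using *(1) by (simp add: wf_mdp_def)
  then have HK: "1 \<le> real (horizon M) * real K"
    using *(2) mult_mono[of 1 "real (horizon M)" 1 "real K"] by simp
  interpret rsvi2 M \<beta> K ?\<delta> using * HK H by unfold_locales auto
  let ?X = "real H * real S * real A * real K" and ?r = "regret_scale M \<beta>"
  have s: "1 \<le> real S" "1 \<le> real A" using S_pos A_pos by auto
  have HKX: "real H * real K * 1 \<le> real H * real K * (real S * real A)"
    using s HK mult_mono[of 1 "real S" 1 "real A"] by (intro mult_left_mono) auto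
  have X2: "2 \<le> ?X"
    using two_le_A HK s mult_mono[of 1 "real H * real K" 2 "real S * real A"]
      mult_mono[of 1 "real S" 2 "real A"] by (simp add: mult_ac)
  have "ln 2 \<le> ln ?X" using X2 by (intro ln_mono) auto
  then have L: "1 / 2 \<le> ln ?X" using ln2_ge_two_thirds by linarith
  \<comment> \<open>This confidence level at most squares the argument of the logarithm, so the
    logarithm at most doubles and its square at most quadruples.\<close>
  have "?X / ?\<delta> = ?X * (real H * real K)" by simp
  also have "\<dots> \<le> ?X * ?X" using HKX X2 by (intro mult_left_mono) (auto simp: mult_ac)
  finally have "ln (?X / ?\<delta>) \<le> ln (?X * ?X)" using X2 HK by (intro ln_mono) auto
  also have "\<dots> = 2 * ln ?X" using X2 by (subst ln_mult_pos) auto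
  finally have upper: "ln (?X / ?\<delta>) \<le> 2 * ln ?X" .
  have "1 * ?X \<le> real H * real K * ?X" using X2 HK by (intro mult_right_mono) auto
  then have "0 \<le> ln (?X / ?\<delta>)" using X2 by (intro ln_ge_zero) (auto simp: mult_ac)
  then have sq: "(ln (?X / ?\<delta>))\<^sup>2 \<le> (2 * ln ?X)\<^sup>2" using upper by (intro power_mono)
  have "(1 / 2)\<^sup>2 \<le> (ln ?X)\<^sup>2" using L by (intro power_mono) auto
  then have one: "1 \<le> 4 * (ln ?X)\<^sup>2" by (simp add: power2_eq_square)
  \<comment> \<open>On the bad events the trivial regret \<open>H * K\<close> is multiplied by the
    failure probability \<open>1 / (H * K)\<close>. The resulting 1 is at most \<open>?r\<close>
    times \<open>4 * (ln ?X)\<^sup>2\<close>, whence 4196 as 4 times 1048 plus 4.\<close>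
  have "E (hist K) (regret M \<beta> 2 K ?\<delta>) \<le> regret_bound + 1"
  proof -
    have "real H * real K * ?\<delta> = 1" using H *(2) by simp
    then show ?thesis using E_regret_le by simp
  qed
  also have "\<dots> \<le> 1048 * ?r * (2 * ln ?X)\<^sup>2 + ?r * (4 * (ln ?X)\<^sup>2)"
    using order_trans[OF regret_bound_le mult_left_mono[OF sq, of "1048 * ?r"]]
      mult_mono[OF regret_scale_ge(3) one] regret_scale_ge(3) by (intro add_mono) auto
  finally show "E (rsvi2_hist M \<beta> 2 K ?\<delta> K) (regret M \<beta> 2 K ?\<delta>) \<le> 4196 * ?r * (ln ?X)\<^sup>2"
    by (simp add: power_mult_distrib)
qed auto

end
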